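(* Let $G$ be a compact algebraic group, let $\xi$ be a random variable on $G$ with support $\overline{G}:=\operatorname{supp}\xi$, and let $\xi_n$ ($n\in\mathbb{N}$) be independent random variables on $G$, each having the same distribution as $\xi$. Then the following conditions are equivalent: (1) the products $\xi_1\cdot\ldots\cdot\xi_n$ converge in distribution, as $n\to\infty$, to some random variable $\eta$ on $G$; (2) the products $\xi_1\cdot\ldots\cdot\xi_n$ converge in distribution, as $n\to\infty$, to a random variable $\eta$ whose distribution is the uniform distribution $R(\overline{G})$ on $\overline{G}$; (3) for each subgroup $H\subset\overline{G}$ and each coset $Z\in N(H)/H$ such that $\xi\in Z$ almost surely, we have $H=\overline{G}$; (4) for each subgroup $H\subset G$ and each coset $Z\in N(H)/H$ such that $\xi\in Z$ almost surely, we have $Z=H$.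
   Context: A compact algebraic group is a real linear algebraic group that is compact in its real (Euclidean) topology; all topological notions (continuity, Borel $\sigma$-algebra, compactness) refer to this real topology. "Subgroup" of $G$ always means algebraic subgroup. $N(H)$ is the normalizer of $H$ in $G$, and $N(H)/H$ is the set of cosets $bH$ with $b\in N(H)$. A fixed probability space $(\Omega,\mathcal{A},P)$ is given. A random variable on a topological space $X$ is a measurable map $\xi\colon\Omega\to X$ with respect to the Borel $\sigma$-algebra of $X$; its distribution is the probability measure $\mu_\xi(B)=P(\xi\in B)$. Random variables $\zeta_n$ on $X$ converge in distribution to a random variable $\zeta$ on $X$ if $M(f(\zeta_n))\to M(f(\zeta))$ as $n\to\infty$ for every continuous bounded function $f\colon X\to\mathbb{R}$, where $M$ denotes expectation. Support: for a random variable $\xi$ on $G$, the family of all (algebraic) subgroups $H\subset G$ with $\xi\in H$ almost surely is closed under intersection and has a least element by inclusion; this least subgroup is called the support of $\xi$ and denoted $\operatorname{supp}\xi$. Uniform distribution: for a compact algebraic group $K$, $R(K)$ denotes the distribution law given by the Haar probability measure on $K$ (the Borel measure invariant under left and right multiplications with total mass $1$). A random variable with distribution $R(\overline{G})$ is regarded as a random variable on $G$ via the inclusion $\overline{G}\subset G$. *)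

theory Defs
  imports "HOL-Probability.Probability" "HOL-Algebra.Group_Action" "HOL-Algebra.Left_Coset"
begin

definition general_linear :: "(real^'n^'n) monoid" where
  "general_linear = \<lparr>carrier = {A. invertible A}, monoid.mult = (**), one = mat 1\<rparr>"

definition matrix_group :: "(real^'n^'n) set \<Rightarrow> (real^'n^'n) monoid" where
  "matrix_group G = general_linear\<lparr>carrier := G\<rparr>"

text \<open>On real matrices, \<^const>\<open>real_polynomial_function\<close> (the closure of linear functionals
  and constants under sums and products) gives exactly the real polynomials in the entries.
  Allowing also the inverse of the determinant would not change which subsets of the general linear
  group are zero sets, since denominators can be cleared.\<close>

definition zariski_closed :: "(real^'n^'n) set \<Rightarrow> bool" where
  "zariski_closed S \<longleftrightarrow>
     (\<exists>P. (\<forall>p\<in>P. real_polynomial_function p) \<and> S = {A. invertible A \<and> (\<forall>p\<in>P. p A = 0)})"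

definition algebraic_group :: "(real^'n^'n) set \<Rightarrow> bool" where
  "algebraic_group G \<longleftrightarrow> subgroup G general_linear \<and> zariski_closed G"

definition compact_algebraic_group :: "(real^'n^'n) set \<Rightarrow> bool" where
  "compact_algebraic_group G \<longleftrightarrow> algebraic_group G \<and> compact G"

definition algebraic_subgroup :: "(real^'n^'n) set \<Rightarrow> (real^'n^'n) set \<Rightarrow> bool" where
  "algebraic_subgroup H G \<longleftrightarrow> subgroup H (matrix_group G) \<and> zariski_closed H"

definition normalizer_cosets :: "(real^'n^'n) set \<Rightarrow> (real^'n^'n) set \<Rightarrow> (real^'n^'n) set set" where
  "normalizer_cosets G H =
     lcosets\<^bsub>(matrix_group G)\<lparr>carrier := normalizer (matrix_group G) H\<rparr>\<^esub> H"

abbreviation borel_on :: "'a::topological_space set \<Rightarrow> 'a measure" where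
  "borel_on X \<equiv> restrict_space borel X"

text \<open>The order on sets is inclusion, so \<^const>\<open>Least\<close> picks the least subgroup by inclusion.\<close>

definition supp :: "'w measure \<Rightarrow> (real^'n^'n) set \<Rightarrow> ('w \<Rightarrow> real^'n^'n) \<Rightarrow> (real^'n^'n) set" where
  "supp M G \<xi> = (LEAST H. algebraic_subgroup H G \<and> (AE \<omega> in M. \<xi> \<omega> \<in> H))"

definition converges_in_distribution ::
  "'w measure \<Rightarrow> 'a::topological_space set \<Rightarrow> (nat \<Rightarrow> 'w \<Rightarrow> 'a) \<Rightarrow> ('w \<Rightarrow> 'a) \<Rightarrow> bool" where
  "converges_in_distribution M X \<zeta> \<eta> \<longleftrightarrow>
     (\<forall>f :: 'a \<Rightarrow> real. continuous_on X f \<and> bounded (f ` X) \<longrightarrow>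
        (\<lambda>n. \<integral>\<omega>. f (\<zeta> n \<omega>) \<partial>M) \<longlonglongrightarrow> (\<integral>\<omega>. f (\<eta> \<omega>) \<partial>M))"

definition haar_probability :: "(real^'n^'n) set \<Rightarrow> (real^'n^'n) measure \<Rightarrow> bool" where
  "haar_probability K \<nu> \<longleftrightarrow>
     prob_space \<nu> \<and> sets \<nu> = sets (borel_on K) \<and>
     (\<forall>g\<in>K. distr \<nu> (borel_on K) (\<lambda>x. g ** x) = \<nu> \<and> distr \<nu> (borel_on K) (\<lambda>x. x ** g) = \<nu>)"

text \<open>The Haar probability measure on \<open>K\<close> is transported to \<open>G\<close> along the inclusion.\<close>

definition uniform_law_on ::
  "'w measure \<Rightarrow> (real^'n^'n) set \<Rightarrow> (real^'n^'n) set \<Rightarrow> ('w \<Rightarrow> real^'n^'n) \<Rightarrow> bool" where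
  "uniform_law_on M G K \<eta> \<longleftrightarrow>
     (\<exists>\<nu>. haar_probability K \<nu> \<and> distr M (borel_on G) \<eta> = distr \<nu> (borel_on G) (\<lambda>x. x))"

primrec ordered_product :: "(nat \<Rightarrow> real^'n^'n) \<Rightarrow> nat \<Rightarrow> real^'n^'n" where
  "ordered_product x 0 = mat 1"
| "ordered_product x (Suc n) = ordered_product x n ** x (Suc n)"

end

theory Submission
  imports Defs "HOL-Complex_Analysis.Great_Picard"
begin

text \<open>
  The statement is a form of the Ito--Kawada theorem. Let \<open>\<mu>\<close> be the law of \<open>\<xi>\<close> and \<open>A\<close> its topological
  support, and call the conditions (1) to (4). The proof runs through (1), (4), (3), (2), (1); the
  last implication is trivial.

  From (1) to (4) (\<open>convergence_imp_trivial_coset\<close>): if \<open>\<xi>\<close> lies in \<open>zH\<close> almost surely and \<open>z\<close>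
  normalizes \<open>H\<close>, then the \<open>n\<close>-th product lies in \<open>z^n H\<close>. In a compact group the powers of \<open>z\<close>
  return to the identity (\<open>powers_return_to_one\<close>), say along exponents \<open>k n\<close>. The products of length
  \<open>k n\<close> then approach \<open>H\<close> while those of length \<open>k n + 1\<close> approach \<open>zH\<close>. A limit variable has to
  lie in both of these closed sets, so they meet and \<open>zH = H\<close>.

  From (4) to (3) (\<open>trivial_cosets_imp_full_subgroup\<close>): by (4) the subgroup itself carries \<open>\<xi>\<close>, and the
  support of \<open>\<xi>\<close> is the least algebraic subgroup that does.

  From (3) to (2) (\<open>full_subgroup_imp_haar_limit\<close>): fix \<open>s \<in> A\<close>. The sets \<open>s^-j A^j\<close> increase with
  \<open>j\<close>, and the closure \<open>E\<close> of their union is a compact group which \<open>s\<close> normalizes and for which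
  \<open>A \<subseteq> sE\<close>. A compact matrix group is the zero set of polynomials, because averaging a polynomial over
  the group gives an invariant polynomial, and these separate the group from the points outside
  (\<open>compact_matrix_group.zariski_closed\<close>). So (3) applies to \<open>E\<close> and gives \<open>E = K\<close>, where \<open>K\<close> is
  the support of \<open>\<xi>\<close>. This density drives the random walk to equilibrium
  (\<open>random_walk.iter_converges_uniformly\<close>). Let \<open>step f x = \<integral> f (x y) d\<mu>(y)\<close>. The iterates of \<open>step\<close> on a
  continuous \<open>f\<close> are equicontinuous, hence some subsequence has a uniform limit \<open>g\<close>. The maxima of the
  iterates decrease, so all functions \<open>step^j g\<close> have the same maximum; by the maximum principle \<open>g\<close>
  attains it on a whole translate of \<open>A^j\<close>, for every \<open>j\<close>. As \<open>s^-j A^j\<close> exhausts \<open>K\<close> up to closure,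
  \<open>g\<close> is constant. The limiting constants form a left invariant mean, which is the Haar integral.

  What remains is to find a random variable with the limit law on the given probability space. If
  \<open>A\<close> is a single point, then \<open>E = K\<close> is trivial. Otherwise the independent copies of \<open>\<xi>\<close> provide a real
  variable without atoms (\<open>prob_space.exists_atomless_variable\<close>), from which quantile functions
  produce every real law. Schoenberg's space-filling curve carries this over to compact sets in
  Euclidean spaces, and Helly's selection theorem supplies the limit law itself
  (\<open>prob_space.weak_limit_of_subsequence\<close>).
\<close>

section \<open>Compact groups of matrices\<close>

locale compact_matrix_group =
  fixes K :: "(real^'n^'n) set"
  assumes compact: "compact K"
    and one_mem: "mat 1 \<in> K"
    and mult_mem: "\<And>x y. x \<in> K \<Longrightarrow> y \<in> K \<Longrightarrow> x ** y \<in> K"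
    and invertible: "\<And>x. x \<in> K \<Longrightarrow> invertible x"
    and inv_mem: "\<And>x. x \<in> K \<Longrightarrow> matrix_inv x \<in> K"

abbreviation matrix_power :: "real^'n^'n \<Rightarrow> nat \<Rightarrow> real^'n^'n" where
  "matrix_power s \<equiv> ordered_product (\<lambda>_. s)"

primrec set_power :: "(real^'n^'n) set \<Rightarrow> nat \<Rightarrow> (real^'n^'n) set" where
  "set_power A 0 = {mat 1}"
| "set_power A (Suc n) = {x ** y | x y. x \<in> A \<and> y \<in> set_power A n}"

lemma matrix_power_add: "matrix_power s (m + n) = matrix_power s m ** matrix_power s n"
  by (induction n) (auto simp: matrix_mul_assoc)

lemma matrix_power_Suc_left: "matrix_power s (Suc n) = s ** matrix_power s n"
  using matrix_power_add[of s 1 n] by simp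

lemma matrix_power_in_set_power: "s \<in> A \<Longrightarrow> matrix_power s n \<in> set_power A n"
  by (induction n) (auto simp: matrix_power_Suc_left simp del: ordered_product.simps(2))

lemma set_power_add:
  "x \<in> set_power A m \<Longrightarrow> y \<in> set_power A n \<Longrightarrow> x ** y \<in> set_power A (m + n)"
proof (induction m arbitrary: x)
  case (Suc m)
  then obtain u v where "x = u ** v" "u \<in> A" "v \<in> set_power A m" by auto
  then show ?case using Suc.IH[of v] Suc.prems(2) by (auto simp: matrix_mul_assoc[symmetric])
qed simp

lemma continuous_on_matrix_mult [continuous_intros]:
  fixes f g :: "'a::topological_space \<Rightarrow> real^'n^'n"
  assumes "continuous_on S f" "continuous_on S g"
  shows "continuous_on S (\<lambda>x. f x ** g x)"
  unfolding matrix_matrix_mult_def using assms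
  by (intro continuous_intros continuous_on_vec_lambda)

lemma tendsto_matrix_mult [tendsto_intros]:
  fixes f g :: "'a \<Rightarrow> real^'n^'n"
  assumes "(f \<longlongrightarrow> a) F" "(g \<longlongrightarrow> b) F"
  shows "((\<lambda>x. f x ** g x) \<longlongrightarrow> a ** b) F"
  unfolding matrix_matrix_mult_def using assms
  by (intro tendsto_intros)

lemma
  fixes A :: "real^'n^'n"
  assumes "invertible A"
  shows matrix_inv_right: "A ** matrix_inv A = mat 1" and matrix_inv_left: "matrix_inv A ** A = mat 1"
proof -
  have "\<exists>B. A ** B = mat 1 \<and> B ** A = mat 1" using assms by (simp add: invertible_def)
  then have "A ** matrix_inv A = mat 1 \<and> matrix_inv A ** A = mat 1"
    unfolding matrix_inv_def by (rule someI_ex)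
  then show "A ** matrix_inv A = mat 1" "matrix_inv A ** A = mat 1" by auto
qed

lemma matrix_inv_mult_cancel:
  fixes A :: "real^'n^'n"
  assumes "invertible A"
  shows "A ** (matrix_inv A ** B) = B" "matrix_inv A ** (A ** B) = B"
    "B ** A ** matrix_inv A = B" "B ** matrix_inv A ** A = B"
  using matrix_inv_right[OF assms] matrix_inv_left[OF assms]
  by (simp_all add: matrix_mul_assoc)
    (simp_all add: matrix_mul_assoc[symmetric])

lemma invertible_mult_cancel_left:
  fixes s a b :: "real^'n^'n"
  assumes "invertible s" "s ** a = s ** b"
  shows "a = b"
  by (metis assms matrix_inv_mult_cancel(2))

lemma matrix_inv_unique:
  fixes A :: "real^'n^'n"
  assumes "A ** B = mat 1"
  shows "matrix_inv A = B"
proof -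
  have "invertible A" using assms invertible_right_inverse by blast
  then show ?thesis using matrix_inv_mult_cancel(2)[of A B] by (simp add: assms)
qed

lemma compact_convergent_subsequence:
  fixes f :: "nat \<Rightarrow> 'a::metric_space"
  assumes "compact C" "\<And>n. f n \<in> C"
  obtains l r where "l \<in> C" "strict_mono (r :: nat \<Rightarrow> nat)" "(\<lambda>n. f (r n)) \<longlonglongrightarrow> l"
  using assms seq_compactE[of C f] unfolding compact_eq_seq_compact_metric comp_def by blast

text \<open>By compactness the powers of \<open>s\<close> accumulate somewhere, and the quotient of two powers that are both
  close to an accumulation point is close to the identity.\<close>

lemma powers_return_to_one:
  fixes s :: "real^'n^'n"
  assumes "compact C" "\<And>n. matrix_power s n \<in> C" "\<And>x. x \<in> C \<Longrightarrow> invertible x"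
  obtains k :: "nat \<Rightarrow> nat" where "\<And>n. n \<le> k n" "(\<lambda>n. matrix_power s (k n)) \<longlonglongrightarrow> mat 1"
proof -
  obtain a r where a: "a \<in> C" and r: "strict_mono r" and lim: "(\<lambda>n. matrix_power s (r n)) \<longlonglongrightarrow> a"
    using compact_convergent_subsequence[OF assms(1), of "matrix_power s"] assms(2) by blast
  have r_le: "m \<le> r m" for m by (rule seq_suble[OF r])
  \<comment> \<open>The offset \<open>r n\<close> makes the gap between the two exponents at least \<open>n\<close>.\<close>
  define d where "d n = r (n + r n) - r n" for n
  have d_split: "r (n + r n) = r n + d n" for n
    using r_le[of "n + r n"] by (simp add: d_def)
  have d_le: "n \<le> d n" for n using r_le[of "n + r n"] by (simp add: d_def)
  obtain b q where q: "strict_mono q" and limb: "(\<lambda>n. matrix_power s (d (q n))) \<longlonglongrightarrow> b"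
    using compact_convergent_subsequence[OF assms(1), of "\<lambda>n. matrix_power s (d n)"] assms(2) by blast
  have "(\<lambda>n. matrix_power s (r (q n)) ** matrix_power s (d (q n))) \<longlonglongrightarrow> a ** b"
    using LIMSEQ_subseq_LIMSEQ[OF lim q] limb by (intro tendsto_intros) (simp_all add: comp_def)
  moreover have "strict_mono (\<lambda>n. q n + r (q n))"
    using r q by (auto simp: strict_mono_def intro!: add_strict_mono)
  then have "(\<lambda>n. matrix_power s (r (q n + r (q n)))) \<longlonglongrightarrow> a"
    by (intro filterlim_compose[OF lim] filterlim_subseq)
  then have "(\<lambda>n. matrix_power s (r (q n)) ** matrix_power s (d (q n))) \<longlonglongrightarrow> a"
    by (simp add: d_split matrix_power_add)
  ultimately have "a ** b = a ** mat 1"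
    using LIMSEQ_unique by simp blast
  then have "b = mat 1" using a assms(3) invertible_mult_cancel_left by blast
  moreover have "n \<le> d (q n)" for n using d_le[of "q n"] seq_suble[OF q, of n] by linarith
  ultimately show thesis using limb that[of "\<lambda>n. d (q n)"] by simp
qed

text \<open>If \<open>s^(k n)\<close> tends to the identity, then every accumulation point of \<open>s^(k n - 1)\<close> is an inverse of \<open>s\<close>,
  and it lies in the semigroup.\<close>

lemma compact_semigroup_is_group:
  fixes C :: "(real^'n^'n) set"
  assumes "compact C" "mat 1 \<in> C" and mult: "\<And>x y. x \<in> C \<Longrightarrow> y \<in> C \<Longrightarrow> x ** y \<in> C"
    and inv: "\<And>x. x \<in> C \<Longrightarrow> invertible x"
  shows "compact_matrix_group C"
proof
  fix s assume s: "s \<in> C"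
  have pow: "matrix_power s n \<in> C" for n by (induction n) (auto simp: assms(2) mult s)
  obtain k :: "nat \<Rightarrow> nat" where k: "\<And>n. n \<le> k n" "(\<lambda>n. matrix_power s (k n)) \<longlonglongrightarrow> mat 1"
    using powers_return_to_one[OF assms(1) pow inv] by blast
  obtain b q where b: "b \<in> C" and q: "strict_mono q"
    and lim: "(\<lambda>n. matrix_power s (k (Suc (q n)) - 1)) \<longlonglongrightarrow> b"
    using compact_convergent_subsequence[OF assms(1), of "\<lambda>n. matrix_power s (k (Suc n) - 1)"] pow
    by blast
  have "s ** matrix_power s (k (Suc (q n)) - 1) = matrix_power s (k (Suc (q n)))" for n
    using k(1)[of "Suc (q n)"] by (simp flip: matrix_power_Suc_left)
  moreover have "(\<lambda>n. s ** matrix_power s (k (Suc (q n)) - 1)) \<longlonglongrightarrow> s ** b"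
    by (intro tendsto_intros lim)
  moreover have "(\<lambda>n. matrix_power s (k (Suc (q n)))) \<longlonglongrightarrow> mat 1"
    by (rule filterlim_compose[OF k(2)], rule filterlim_compose[OF filterlim_Suc], rule filterlim_subseq[OF q])
  ultimately have "s ** b = mat 1" using LIMSEQ_unique by auto
  then have "s ** b = s ** matrix_inv s" by (simp add: matrix_inv_right inv s)
  then show "matrix_inv s \<in> C" using invertible_mult_cancel_left[OF inv[OF s]] b by blast
qed (use assms in auto)

lemma matrix_inv_one: "matrix_inv (mat 1 :: real^'n^'n) = mat 1"
  by (rule matrix_inv_unique) (rule matrix_mul_lid)

context compact_matrix_group
begin

lemma closed: "closed K"
  using compact by (rule compact_imp_closed)

lemma power_mem: "s \<in> K \<Longrightarrow> matrix_power s n \<in> K"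
  by (induction n) (auto simp: one_mem mult_mem)

lemma inv_right: "x \<in> K \<Longrightarrow> x ** matrix_inv x = mat 1"
  and inv_left: "x \<in> K \<Longrightarrow> matrix_inv x ** x = mat 1"
  by (simp_all add: matrix_inv_right matrix_inv_left invertible)

lemma continuous_on_matrix_inv: "continuous_on K matrix_inv"
proof (rule continuous_from_closed_graph[OF compact])
  \<comment> \<open>The graph of inversion is the set of solutions of \<open>x y = 1\<close>, which is closed.\<close>
  show "matrix_inv \<in> K \<rightarrow> K" using inv_mem by auto
  have "(\<lambda>x. (x, matrix_inv x)) ` K = (K \<times> K) \<inter> {z. fst z ** snd z = mat 1}"
    using matrix_inv_unique inv_mem inv_right by (fastforce simp: image_iff)
  also have "closed \<dots>"
    using closed by (intro closed_Int closed_Times closed_Collect_eq continuous_intros)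
  finally show "closed ((\<lambda>x. (x, matrix_inv x)) ` K)" .
qed

text \<open>The set \<open>increments A s j\<close> is \<open>s^-j A^j\<close>, written without inverses. Normalizing by \<open>s^-j\<close> makes these
  sets increase with \<open>j\<close>, which the sets \<open>A^j\<close> themselves do not.\<close>

definition increments :: "(real^'n^'n) set \<Rightarrow> real^'n^'n \<Rightarrow> nat \<Rightarrow> (real^'n^'n) set" where
  "increments A s j = {y \<in> K. matrix_power s j ** y \<in> set_power A j}"

text \<open>For \<open>s \<in> A \<subseteq> K\<close> this is the smallest closed subgroup \<open>E\<close> normalized by \<open>s\<close> such that \<open>A\<close> lies in the
  coset \<open>sE\<close>: for any such \<open>E\<close> one has \<open>A^j \<subseteq> s^j E\<close>.\<close>

definition increment_group :: "(real^'n^'n) set \<Rightarrow> real^'n^'n \<Rightarrow> (real^'n^'n) set" where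
  "increment_group A s = closure (\<Union>j. increments A s j)"

lemma increments_Suc:
  assumes "s \<in> A" shows "increments A s j \<subseteq> increments A s (Suc j)"
proof
  fix y assume y: "y \<in> increments A s j"
  have "matrix_power s (Suc j) ** y = s ** (matrix_power s j ** y)"
    by (simp only: matrix_power_Suc_left matrix_mul_assoc)
  then show "y \<in> increments A s (Suc j)"
    using y assms by (auto simp: increments_def simp del: ordered_product.simps(2))
qed

lemma increments_mono: "s \<in> A \<Longrightarrow> i \<le> j \<Longrightarrow> increments A s i \<subseteq> increments A s j"
  using lift_Suc_mono_le[of "increments A s"] increments_Suc by blast

text \<open>Moving \<open>s^-j\<close> past \<open>a\<close> conjugates \<open>a\<close> by a power of \<open>s\<close>, so the union of the increments is closed under
  a twisted multiplication only. Powers of \<open>s\<close> close to the identity undo the twist in the limit;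
  this is how \<open>increments_mult\<close> below obtains honest products.\<close>

lemma increments_twisted_mult:
  assumes "s \<in> K" "a \<in> increments A s i" "b \<in> increments A s j"
  shows "matrix_inv (matrix_power s j) ** a ** matrix_power s j ** b \<in> increments A s (i + j)"
proof -
  let ?p = "matrix_power s"
  have K: "?p j \<in> K" "a \<in> K" "b \<in> K" using assms power_mem by (auto simp: increments_def)
  have "?p (i + j) ** (matrix_inv (?p j) ** a ** ?p j ** b) = (?p i ** a) ** (?p j ** b)"
    by (simp add: matrix_power_add matrix_inv_mult_cancel invertible[OF K(1)]
        matrix_mul_assoc[symmetric])
  then show ?thesis
    using assms K set_power_add[of "?p i ** a" A i "?p j ** b" j]
    by (auto simp: increments_def intro!: mult_mem inv_mem)
qed

lemma increment_group_subset: "increment_group A s \<subseteq> K"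
  unfolding increment_group_def by (rule closure_minimal[OF _ closed]) (auto simp: increments_def)

lemma increments_subset_group: "increments A s j \<subseteq> increment_group A s"
  unfolding increment_group_def using closure_subset by (rule subset_trans[rotated]) auto

context
  fixes A :: "(real^'n^'n) set" and s :: "real^'n^'n"
  assumes A: "A \<subseteq> K" and s: "s \<in> A"
begin

lemma s_mem: "s \<in> K" using A s by auto

lemma one_in_increments: "mat 1 \<in> increments A s j"
  using matrix_power_in_set_power[OF s] by (auto simp: increments_def one_mem)

lemma increments_mult:
  assumes a: "a \<in> increments A s i" and b: "b \<in> increments A s j"
  shows "a ** b \<in> increment_group A s"
proof -
  let ?p = "matrix_power s"
  obtain k :: "nat \<Rightarrow> nat" where k: "\<And>n. n \<le> k n" "(\<lambda>n. ?p (k n)) \<longlonglongrightarrow> mat 1"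
    using powers_return_to_one[OF compact power_mem invertible] s_mem by blast
  have K: "a \<in> K" "b \<in> K" using a b by (auto simp: increments_def)
  have inv: "(\<lambda>n. matrix_inv (?p (k n))) \<longlonglongrightarrow> mat 1"
    using continuous_on_tendsto_compose[OF continuous_on_matrix_inv k(2) one_mem]
    by (simp add: power_mem s_mem matrix_inv_one)
  have "(\<lambda>n. matrix_inv (?p (k n)) ** a ** ?p (k n) ** b) \<longlonglongrightarrow> mat 1 ** a ** mat 1 ** b"
    by (intro tendsto_intros inv k)
  then have lim: "(\<lambda>n. matrix_inv (?p (k n)) ** a ** ?p (k n) ** b) \<longlonglongrightarrow> a ** b"
    by simp
  have "eventually (\<lambda>n. matrix_inv (?p (k n)) ** a ** ?p (k n) ** b \<in> increment_group A s) sequentially"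
    using eventually_ge_at_top[of j]
  proof eventually_elim
    case (elim n)
    then have "b \<in> increments A s (k n)"
      using b increments_mono[OF s] k(1)[of n] by (meson order_trans subsetD)
    then show ?case
      by (rule subsetD[OF increments_subset_group increments_twisted_mult[OF s_mem a]])
  qed
  then show ?thesis
    using Lim_in_closed_set[OF _ _ _ lim] by (auto simp: increment_group_def)
qed

lemma increment_group_is_group: "compact_matrix_group (increment_group A s)"
proof (rule compact_semigroup_is_group)
  show "compact (increment_group A s)"
    using compact_Int_closed[OF compact, of "increment_group A s"] increment_group_subset
    by (simp add: increment_group_def inf.absorb2)
  show "mat 1 \<in> increment_group A s"
    by (rule subsetD[OF increments_subset_group one_in_increments])
  show "invertible x" if "x \<in> increment_group A s" for x
    using that increment_group_subset invertible by blast
  fix x y assume "x \<in> increment_group A s" "y \<in> increment_group A s"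
  then obtain u v where uv: "\<And>n. u n \<in> (\<Union>j. increments A s j)" "u \<longlonglongrightarrow> x"
      "\<And>n. v n \<in> (\<Union>j. increments A s j)" "v \<longlonglongrightarrow> y"
    unfolding increment_group_def closure_sequential by blast
  have "u n ** v n \<in> increment_group A s" for n
    using uv(1)[of n] uv(3)[of n] increments_mult by blast
  moreover have "(\<lambda>n. u n ** v n) \<longlonglongrightarrow> x ** y" by (intro tendsto_intros uv)
  ultimately show "x ** y \<in> increment_group A s"
    unfolding increment_group_def by (rule closed_sequentially[OF closed_closure])
qed

lemma conj_increment_group:
  assumes "x \<in> increment_group A s"
  shows "matrix_inv s ** x ** s \<in> increment_group A s"
proof -
  have "matrix_inv s ** y ** s \<in> increment_group A s" if "y \<in> increments A s i" for y i
    using subsetD[OF increments_subset_group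
        increments_twisted_mult[OF s_mem that one_in_increments[of 1]]] by simp
  then have "(\<lambda>y. matrix_inv s ** y ** s) ` (\<Union>i. increments A s i) \<subseteq> increment_group A s" by blast
  then have "(\<lambda>y. matrix_inv s ** y ** s) ` increment_group A s \<subseteq> increment_group A s"
    unfolding increment_group_def
    by (intro image_closure_subset continuous_intros) auto
  then show ?thesis using assms by blast
qed

lemma conj_power_increment_group:
  assumes "x \<in> increment_group A s"
  shows "matrix_inv (matrix_power s n) ** x ** matrix_power s n \<in> increment_group A s"
proof (induction n)
  case 0
  then show ?case using assms by (simp add: matrix_inv_one)
next
  case (Suc n)
  have inv: "matrix_inv (matrix_power s (Suc n)) = matrix_inv s ** matrix_inv (matrix_power s n)"
  proof (rule matrix_inv_unique)
    have "matrix_power s (Suc n) ** (matrix_inv s ** matrix_inv (matrix_power s n))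
        = matrix_power s n ** (s ** (matrix_inv s ** matrix_inv (matrix_power s n)))"
      by (simp add: matrix_mul_assoc)
    then show "matrix_power s (Suc n) ** (matrix_inv s ** matrix_inv (matrix_power s n)) = mat 1"
      by (simp only: matrix_inv_mult_cancel(1)[OF invertible[OF s_mem]] inv_right[OF power_mem[OF s_mem]])
  qed
  show ?case
    using conj_increment_group[OF Suc] unfolding inv by (simp add: matrix_mul_assoc)
qed

text \<open>Conjugation by \<open>s\<close> in the other direction is a limit of conjugations by positive powers of \<open>s\<close>,
  because \<open>s^-1\<close> is a limit of such powers.\<close>

lemma conj_inv_increment_group:
  assumes x: "x \<in> increment_group A s"
  shows "s ** x ** matrix_inv s \<in> increment_group A s"
proof -
  let ?p = "matrix_power s"
  obtain k :: "nat \<Rightarrow> nat" where k: "\<And>n. n \<le> k n" "(\<lambda>n. ?p (k n)) \<longlonglongrightarrow> mat 1"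
    using powers_return_to_one[OF compact power_mem invertible] s_mem by blast
  define q where "q n = ?p (k (Suc n) - 1)" for n
  have sq: "s ** q n = ?p (k (Suc n))" for n
    using k(1)[of "Suc n"] by (simp add: q_def flip: matrix_power_Suc_left)
  have q: "q n \<in> K" for n by (simp add: q_def power_mem s_mem)
  have "(\<lambda>n. matrix_inv s ** ?p (k (Suc n))) \<longlonglongrightarrow> matrix_inv s ** mat 1"
    by (intro tendsto_intros LIMSEQ_Suc[OF k(2)])
  then have lim: "q \<longlonglongrightarrow> matrix_inv s"
    by (simp add: sq[symmetric] matrix_inv_mult_cancel invertible[OF s_mem])
  have "(\<lambda>n. matrix_inv (q n)) \<longlonglongrightarrow> matrix_inv (matrix_inv s)"
    using continuous_on_tendsto_compose[OF continuous_on_matrix_inv lim inv_mem[OF s_mem]] q by simp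
  then have lim': "(\<lambda>n. matrix_inv (q n)) \<longlonglongrightarrow> s"
    using matrix_inv_unique[OF inv_left[OF s_mem]] by simp
  have "(\<lambda>n. matrix_inv (q n) ** x ** q n) \<longlonglongrightarrow> s ** x ** matrix_inv s"
    by (intro tendsto_intros lim lim')
  moreover have "matrix_inv (q n) ** x ** q n \<in> increment_group A s" for n
    unfolding q_def by (rule conj_power_increment_group[OF x])
  ultimately show ?thesis
    unfolding increment_group_def by (rule closed_sequentially[OF closed_closure, rotated])
qed

lemma subset_coset_increment_group:
  assumes "y \<in> A" shows "matrix_inv s ** y \<in> increment_group A s"
proof -
  have "matrix_inv s ** y \<in> increments A s 1"
  proof -
    have "matrix_power s 1 ** (matrix_inv s ** y) = y ** mat 1"
      by (simp add: matrix_inv_mult_cancel(1)[OF invertible[OF s_mem]])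
    moreover have "y ** mat 1 \<in> set_power A 1" using assms by auto
    moreover have "matrix_inv s ** y \<in> K" using mult_mem inv_mem s_mem A assms by blast
    ultimately show ?thesis by (simp only: increments_def mem_Collect_eq)
  qed
  then show ?thesis by (rule subsetD[OF increments_subset_group])
qed

end

end

section \<open>Random walks on a compact group\<close>

text \<open>The law \<open>\<mu>\<close> of a single step lives on \<open>K\<close> itself rather than on the space of all matrices, so that
  functions continuous on \<open>K\<close> alone are integrable.\<close>

locale random_walk = compact_matrix_group K + prob_space \<mu>
  for K :: "(real^'n^'n) set" and \<mu> :: "(real^'n^'n) measure" +
  assumes sets_step_law: "sets \<mu> = sets (borel_on K)"
begin

lemma space_step_law [simp]: "space \<mu> = K"
  using sets_eq_imp_space_eq[OF sets_step_law] by (simp add: space_restrict_space)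

lemma continuous_imp_bounded:
  fixes f :: "real^'n^'n \<Rightarrow> real"
  assumes "continuous_on K f"
  obtains B where "\<And>x. x \<in> K \<Longrightarrow> \<bar>f x\<bar> \<le> B"
  using compact_imp_bounded[OF compact_continuous_image[OF assms compact]]
  unfolding bounded_real by blast

lemma borel_measurable_step_law:
  fixes f :: "real^'n^'n \<Rightarrow> real"
  shows "continuous_on K f \<Longrightarrow> f \<in> borel_measurable \<mu>"
  using borel_measurable_continuous_on_restrict measurable_cong_sets[OF sets_step_law refl] by blast

lemma integrable_step_law:
  fixes f :: "real^'n^'n \<Rightarrow> real"
  assumes "continuous_on K f" shows "integrable \<mu> f"
proof -
  obtain B where "\<And>x. x \<in> K \<Longrightarrow> \<bar>f x\<bar> \<le> B" using continuous_imp_bounded[OF assms] by blast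
  then show ?thesis
    using borel_measurable_step_law[OF assms] by (intro integrable_const_bound[of _ B]) auto
qed

lemma continuous_on_left_mult:
  fixes f :: "real^'n^'n \<Rightarrow> 'b::topological_space"
  assumes "continuous_on K f" "x \<in> K"
  shows "continuous_on K (\<lambda>y. f (x ** y))"
  by (rule continuous_on_compose2[OF assms(1)]) (auto intro!: continuous_intros mult_mem assms(2))

text \<open>The Markov operator of the walk \<open>x, x y, x y y', ...\<close> with independent increments on the right.\<close>

definition step :: "(real^'n^'n \<Rightarrow> real) \<Rightarrow> real^'n^'n \<Rightarrow> real" where
  "step f x = (\<integral>y. f (x ** y) \<partial>\<mu>)"

lemma integrable_step:
  "continuous_on K f \<Longrightarrow> x \<in> K \<Longrightarrow> integrable \<mu> (\<lambda>y. f (x ** y))" for f :: "real^'n^'n \<Rightarrow> real"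
  by (intro integrable_step_law continuous_on_left_mult)

lemma step_le:
  assumes "continuous_on K f" "continuous_on K g" "\<And>k. k \<in> K \<Longrightarrow> f k \<le> g k" "x \<in> K"
  shows "step f x \<le> step g x"
  unfolding step_def using assms by (intro integral_mono integrable_step) (auto intro: mult_mem)

lemma step_const [simp]: "step (\<lambda>_. c) = (\<lambda>_. c)"
  by (rule ext) (simp add: step_def prob_space[unfolded space_step_law])

lemma step_cong: "(\<And>k. k \<in> K \<Longrightarrow> f k = g k) \<Longrightarrow> x \<in> K \<Longrightarrow> step f x = step g x"
  unfolding step_def by (intro Bochner_Integration.integral_cong) (auto intro: mult_mem)

lemma step_linear:
  assumes "continuous_on K f" "continuous_on K g" "x \<in> K"
  shows "step (\<lambda>y. a * f y + b * g y) x = a * step f x + b * step g x"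
  unfolding step_def using assms by (simp add: integrable_step)

text \<open>A modulus of continuity that is uniform over all right translates survives averaging. This gives
  equicontinuity of the iterates.\<close>

lemma step_modulus:
  assumes f: "continuous_on K f" and x: "x \<in> K" "x' \<in> K"
    and e: "\<And>k. k \<in> K \<Longrightarrow> \<bar>f (x ** k) - f (x' ** k)\<bar> \<le> e" and k: "k \<in> K"
  shows "\<bar>step f (x ** k) - step f (x' ** k)\<bar> \<le> e"
proof -
  have int: "integrable \<mu> (\<lambda>y. f (x ** k ** y))" "integrable \<mu> (\<lambda>y. f (x' ** k ** y))"
    using f x k by (auto intro!: integrable_step mult_mem)
  have "\<bar>step f (x ** k) - step f (x' ** k)\<bar> = \<bar>\<integral>y. f (x ** k ** y) - f (x' ** k ** y) \<partial>\<mu>\<bar>"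
    using int by (simp add: step_def)
  also have "\<dots> \<le> (\<integral>y. \<bar>f (x ** k ** y) - f (x' ** k ** y)\<bar> \<partial>\<mu>)"
    by (rule integral_abs_bound)
  also have "\<dots> \<le> (\<integral>y. e \<partial>\<mu>)"
    using int e k by (intro integral_mono) (auto simp: matrix_mul_assoc[symmetric] intro!: mult_mem)
  finally show ?thesis by (simp add: prob_space[unfolded space_step_law])
qed

lemma uniform_modulus:
  fixes f :: "real^'n^'n \<Rightarrow> real"
  assumes f: "continuous_on K f" and "0 < e"
  obtains d where "0 < d" "\<And>x x' k. \<lbrakk>x \<in> K; x' \<in> K; k \<in> K; dist x x' < d\<rbrakk> \<Longrightarrow> \<bar>f (x ** k) - f (x' ** k)\<bar> \<le> e"
proof -
  have "continuous_on (K \<times> K) (\<lambda>z. f (fst z ** snd z))"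
    by (rule continuous_on_compose2[OF f]) (auto intro!: continuous_intros mult_mem)
  then have "uniformly_continuous_on (K \<times> K) (\<lambda>z. f (fst z ** snd z))"
    by (intro compact_uniformly_continuous compact_Times compact)
  then obtain d where d: "0 < d" "\<And>z z'. z \<in> K \<times> K \<Longrightarrow> z' \<in> K \<times> K \<Longrightarrow> dist z' z < d \<Longrightarrow>
      dist (f (fst z' ** snd z')) (f (fst z ** snd z)) < e"
    using \<open>0 < e\<close> unfolding uniformly_continuous_on_def by meson
  show thesis
    using d(2)[of "(_, _)" "(_, _)"] by (intro that[OF d(1)]) (force simp: dist_Pair_Pair dist_real_def)
qed

lemma iter_continuous: "continuous_on K f \<Longrightarrow> continuous_on K ((step ^^ n) f)"
  and iter_modulus: "\<lbrakk>continuous_on K f; x \<in> K; x' \<in> K;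
    \<And>k. k \<in> K \<Longrightarrow> \<bar>f (x ** k) - f (x' ** k)\<bar> \<le> e; k \<in> K\<rbrakk>
    \<Longrightarrow> \<bar>(step ^^ n) f (x ** k) - (step ^^ n) f (x' ** k)\<bar> \<le> e"
proof -
  have step_cont: "continuous_on K (step f)" if f: "continuous_on K f" for f
    unfolding continuous_on_iff
  proof (intro ballI allI impI)
    fix x and e :: real assume "x \<in> K" "0 < e"
    obtain d where d: "0 < d" "\<And>x x' k. \<lbrakk>x \<in> K; x' \<in> K; k \<in> K; dist x x' < d\<rbrakk>
        \<Longrightarrow> \<bar>f (x ** k) - f (x' ** k)\<bar> \<le> e / 2"
      using uniform_modulus[OF f, of "e / 2"] \<open>0 < e\<close> by auto
    have "dist (step f x') (step f x) < e" if "x' \<in> K" "dist x' x < d" for x'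
      using step_modulus[OF f \<open>x' \<in> K\<close> \<open>x \<in> K\<close> _ one_mem, of "e / 2"] d(2)[of x' x] that \<open>x \<in> K\<close> \<open>0 < e\<close>
      by (force simp: dist_real_def)
    with d(1) show "\<exists>d>0. \<forall>x'\<in>K. dist x' x < d \<longrightarrow> dist (step f x') (step f x) < e" by blast
  qed
  show cont: "continuous_on K ((step ^^ n) f)" if "continuous_on K f" for f n
    using that by (induction n) (auto intro: step_cont)
  show "\<bar>(step ^^ n) f (x ** k) - (step ^^ n) f (x' ** k)\<bar> \<le> e"
    if "continuous_on K f" "x \<in> K" "x' \<in> K" "\<And>k. k \<in> K \<Longrightarrow> \<bar>f (x ** k) - f (x' ** k)\<bar> \<le> e" "k \<in> K"
    using that(5)
  proof (induction n arbitrary: k)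
    case (Suc n)
    show ?case using step_modulus[OF cont[OF that(1)] that(2,3) Suc.IH Suc.prems] by simp
  qed (use that(4) in simp)
qed

lemma iter_le:
  assumes "continuous_on K f" "continuous_on K g" "\<And>k. k \<in> K \<Longrightarrow> f k \<le> g k" "x \<in> K"
  shows "(step ^^ n) f x \<le> (step ^^ n) g x"
  using assms(4)
proof (induction n arbitrary: x)
  case (Suc n)
  then show ?case using step_le[OF iter_continuous iter_continuous] assms(1,2) by simp
qed (use assms(3) in simp)

lemma iter_const [simp]: "(step ^^ n) (\<lambda>_. c) = (\<lambda>_. c)"
  by (induction n) auto

lemma iter_linear:
  assumes "continuous_on K f" "continuous_on K g" "x \<in> K"
  shows "(step ^^ n) (\<lambda>y. a * f y + b * g y) x = a * (step ^^ n) f x + b * (step ^^ n) g x"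
  using assms(3)
proof (induction n arbitrary: x)
  case (Suc n)
  have "(step ^^ Suc n) (\<lambda>y. a * f y + b * g y) x
      = step (\<lambda>y. a * (step ^^ n) f y + b * (step ^^ n) g y) x"
    using Suc by (auto intro!: step_cong)
  then show ?case using step_linear[OF iter_continuous iter_continuous] assms(1,2) Suc.prems by simp
qed simp

lemma iter_contraction:
  assumes "continuous_on K f" "continuous_on K g" "\<And>k. k \<in> K \<Longrightarrow> \<bar>f k - g k\<bar> \<le> e" "x \<in> K"
  shows "\<bar>(step ^^ n) f x - (step ^^ n) g x\<bar> \<le> e"
proof -
  define d where "d y = 1 * f y + (-1) * g y" for y
  have d: "continuous_on K d" unfolding d_def by (intro continuous_intros assms)
  have bounds: "d k \<le> e" "- e \<le> d k" if "k \<in> K" for k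
    using assms(3)[OF that] by (auto simp: d_def abs_le_iff)
  have "(step ^^ n) d x \<le> e" "- e \<le> (step ^^ n) d x"
    using iter_le[OF d continuous_on_const bounds(1) assms(4), of n]
      iter_le[OF continuous_on_const d bounds(2) assms(4), of n] by simp_all
  then show ?thesis
    using iter_linear[OF assms(1,2,4), of n 1 "-1"] unfolding d_def by (simp add: abs_le_iff)
qed

definition topological_support :: "(real^'n^'n) set" where
  "topological_support = {y \<in> K. \<forall>e>0. 0 < measure \<mu> (ball y e \<inter> K)}"

lemma topological_support_subset: "topological_support \<subseteq> K"
  by (auto simp: topological_support_def)

text \<open>The complement is covered by null sets from a countable basis.\<close>

lemma AE_topological_support: "AE y in \<mu>. y \<in> topological_support"
proof -
  obtain \<B> :: "(real^'n^'n) set set" where B: "countable \<B>" "topological_basis \<B>"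
    using ex_countable_basis by blast
  let ?N = "{U \<in> \<B>. measure \<mu> (U \<inter> K) = 0}"
  have "AE y in \<mu>. \<forall>U\<in>?N. y \<notin> U"
  proof (subst AE_ball_countable)
    show "countable ?N" using B(1) by (rule countable_subset[rotated]) auto
    show "\<forall>U\<in>?N. AE y in \<mu>. y \<notin> U"
    proof
      fix U assume U: "U \<in> ?N"
      then have "open U" using B(2) topological_basis_open by blast
      then have "U \<inter> K \<in> sets \<mu>" by (auto simp: sets_step_law sets_restrict_space)
      then have "U \<inter> K \<in> null_sets \<mu>" using U by (auto simp: null_sets_def emeasure_eq_measure)
      then have "AE y in \<mu>. y \<notin> U \<inter> K" by (rule AE_not_in)
      then show "AE y in \<mu>. y \<notin> U" by (rule AE_mp) (auto intro!: AE_I2)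
    qed
  qed
  then show ?thesis
  proof (rule AE_mp, intro AE_I2 impI)
    fix y assume y: "y \<in> space \<mu>" "\<forall>U\<in>?N. y \<notin> U"
    have "0 < measure \<mu> (ball y e \<inter> K)" if "0 < e" for e
    proof (rule ccontr)
      assume "\<not> 0 < measure \<mu> (ball y e \<inter> K)"
      then have 0: "measure \<mu> (ball y e \<inter> K) = 0" using measure_nonneg[of \<mu> "ball y e \<inter> K"] by linarith
      obtain U where U: "U \<in> \<B>" "y \<in> U" "U \<subseteq> ball y e"
        using topological_basisE[OF B(2), of "ball y e" y] \<open>0 < e\<close> by auto
      have "measure \<mu> (U \<inter> K) \<le> measure \<mu> (ball y e \<inter> K)"
        using U by (intro finite_measure_mono) (auto simp: sets_step_law sets_restrict_space)
      then have "measure \<mu> (U \<inter> K) = 0" using 0 measure_nonneg[of \<mu> "U \<inter> K"] by linarith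
      then show False using y U by blast
    qed
    then show "y \<in> topological_support" using y by (simp add: topological_support_def)
  qed
qed

text \<open>An average of values below \<open>m\<close> equals \<open>m\<close> only if almost all of the values equal \<open>m\<close>; continuity
  extends this to every point of the topological support.\<close>

lemma step_maximum_principle:
  assumes f: "continuous_on K f" "\<And>k. k \<in> K \<Longrightarrow> f k \<le> m"
    and x: "x \<in> K" "step f x = m" and y: "y \<in> topological_support"
  shows "f (x ** y) = m"
proof (rule ccontr)
  assume "f (x ** y) \<noteq> m"
  have yK: "y \<in> K" using y topological_support_subset by blast
  then have "f (x ** y) < m" using f(2) x(1) mult_mem \<open>f (x ** y) \<noteq> m\<close> by (simp add: order_less_le)
  then obtain d where d: "0 < d" "\<And>y'. y' \<in> K \<Longrightarrow> dist y' y < d \<Longrightarrow> f (x ** y') < m"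
    using continuous_on_left_mult[OF f(1) x(1), unfolded continuous_on_iff, rule_format, OF yK,
        of "m - f (x ** y)"] unfolding dist_real_def by (smt (verit, best))
  have int: "integrable \<mu> (\<lambda>y. f (x ** y))" by (rule integrable_step[OF f(1) x(1)])
  have "(\<integral>y. m - f (x ** y) \<partial>\<mu>) = 0"
    using int x(2) by (simp add: step_def prob_space[unfolded space_step_law])
  then have "AE y in \<mu>. m - f (x ** y) = 0"
    using int f(2) x(1) by (subst (asm) integral_nonneg_eq_0_iff_AE) (auto simp: mult_mem)
  then have "AE y' in \<mu>. y' \<notin> ball y d \<inter> K"
    by (rule AE_mp) (use d(2) in \<open>auto intro!: AE_I2 simp: dist_commute\<close>)
  moreover have "ball y d \<inter> K \<in> sets \<mu>" by (auto simp: sets_step_law sets_restrict_space)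
  ultimately have "measure \<mu> (ball y d \<inter> K) = 0"
    by (intro measure_eq_0_null_sets) (simp only: AE_iff_null_sets)
  then show False using y d(1) by (auto simp: topological_support_def)
qed

lemma iter_maximum_principle:
  assumes f: "continuous_on K f" "\<And>k. k \<in> K \<Longrightarrow> f k \<le> m"
    and "x \<in> K" "(step ^^ n) f x = m" "t \<in> set_power topological_support n"
  shows "f (x ** t) = m"
  using assms(3-5)
proof (induction n arbitrary: x t)
  case (Suc n)
  obtain u v where t: "t = u ** v" "u \<in> topological_support" "v \<in> set_power topological_support n"
    using Suc.prems(3) by auto
  have le: "(step ^^ n) f k \<le> m" if "k \<in> K" for k
    using iter_le[OF f(1) continuous_on_const f(2) that, of n] by simp
  have "(step ^^ n) f (x ** u) = m"
    using step_maximum_principle[OF iter_continuous[OF f(1)] le Suc.prems(1) _ t(2)] Suc.prems(2)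
    by simp
  then have "f (x ** u ** v) = m"
    using Suc.IH t Suc.prems(1) topological_support_subset mult_mem by blast
  then show ?case by (simp add: t(1) matrix_mul_assoc)
qed simp

lemma continuous_attains_Sup:
  fixes f :: "real^'n^'n \<Rightarrow> real"
  assumes "continuous_on K f"
  shows "\<exists>x\<in>K. f x = (SUP k\<in>K. f k)" and "\<And>k. k \<in> K \<Longrightarrow> f k \<le> (SUP k\<in>K. f k)"
proof -
  obtain x where x: "x \<in> K" "\<And>k. k \<in> K \<Longrightarrow> f k \<le> f x"
    using continuous_attains_sup[OF compact _ assms] one_mem by blast
  then have "(SUP k\<in>K. f k) = f x" by (intro cSup_eq_maximum) auto
  then show "\<exists>x\<in>K. f x = (SUP k\<in>K. f k)" "\<And>k. k \<in> K \<Longrightarrow> f k \<le> (SUP k\<in>K. f k)"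
    using x by auto
qed

text \<open>Uniform mixing, the analytic core of the proof. The limit function \<open>g\<close> attains its maximum on translates
  \<open>z j (s^-j A^j)\<close> of the increments for every \<open>j\<close>. Since the increments are increasing, an accumulation point
  \<open>w\<close> of the elements \<open>z j\<close> works for all of them at once, and by density \<open>g\<close> is constant on \<open>w K = K\<close>.\<close>

theorem iter_converges_uniformly:
  assumes f: "continuous_on K f" and s: "s \<in> topological_support"
    and dense: "K \<subseteq> increment_group topological_support s"
  shows "\<exists>c. \<forall>e>0. \<exists>N. \<forall>n\<ge>N. \<forall>x\<in>K. \<bar>(step ^^ n) f x - c\<bar> < e"
proof -
  define u where "u n = (step ^^ n) f" for n
  let ?hi = "\<lambda>h. SUP k\<in>K. h k :: real"
  have u_cont: "continuous_on K (u n)" for n unfolding u_def by (rule iter_continuous[OF f])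
  have u_add: "u (n + j) = (step ^^ j) (u n)" for n j by (simp add: u_def funpow_add add.commute[of n])
  obtain B where B: "\<And>x. x \<in> K \<Longrightarrow> \<bar>f x\<bar> \<le> B" using continuous_imp_bounded[OF f] by blast
  have u_bound: "\<bar>u n x\<bar> \<le> B" if "x \<in> K" for n x
    using iter_contraction[OF f _ _ that, of "\<lambda>_. 0" B n] B by (simp add: u_def)
  obtain g k where g: "continuous_on K g" and k: "strict_mono (k :: nat \<Rightarrow> nat)"
    and lim: "\<And>e. 0 < e \<Longrightarrow> \<exists>N. \<forall>n x. n \<ge> N \<and> x \<in> K \<longrightarrow> norm (u (k n) x - g x) < e"
  proof (rule Arzela_Ascoli[OF compact, of u B])
    fix x and e :: real assume x: "x \<in> K" and e: "0 < e"
    obtain d where d: "0 < d" "\<And>x x' k. \<lbrakk>x \<in> K; x' \<in> K; k \<in> K; dist x x' < d\<rbrakk>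
        \<Longrightarrow> \<bar>f (x ** k) - f (x' ** k)\<bar> \<le> e / 2"
      using uniform_modulus[OF f, of "e / 2"] e by auto
    have "norm (u n x - u n y) < e" if y: "y \<in> K" "norm (x - y) < d" for n y
    proof -
      have "\<bar>(step ^^ n) f (x ** mat 1) - (step ^^ n) f (y ** mat 1)\<bar> \<le> e / 2"
        using x y d(2) by (intro iter_modulus f one_mem) (auto simp: dist_norm)
      then show ?thesis using e by (simp add: u_def)
    qed
    then show "\<exists>d>0. \<forall>n y. y \<in> K \<and> norm (x - y) < d \<longrightarrow> norm (u n x - u n y) < e" using d(1) by blast
  qed (use u_bound in auto)
  \<comment> \<open>The maximum is a nonexpansive functional in the uniform norm.\<close>
  have hi_diff: "\<bar>?hi a - ?hi b\<bar> \<le> e"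
    if "continuous_on K a" "continuous_on K b" "\<And>x. x \<in> K \<Longrightarrow> \<bar>a x - b x\<bar> \<le> e" for a b e
    using that continuous_attains_Sup[OF that(1)] continuous_attains_Sup[OF that(2)]
    by (smt (verit, ccfv_threshold))
  have "decseq (\<lambda>n. ?hi (u n))"
  proof (rule decseq_SucI)
    fix n
    obtain x where x: "x \<in> K" "u (Suc n) x = ?hi (u (Suc n))"
      using continuous_attains_Sup(1)[OF u_cont] by blast
    have "u (Suc n) x \<le> step (\<lambda>_. ?hi (u n)) x"
      using step_le[OF u_cont[of n] _ continuous_attains_Sup(2)[OF u_cont] x(1)] by (simp add: u_def)
    then show "?hi (u (Suc n)) \<le> ?hi (u n)" using x by simp
  qed
  moreover have "- B \<le> ?hi (u n)" for n
    using continuous_attains_Sup(2)[OF u_cont one_mem, of n] u_bound[OF one_mem, of n] by linarith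
  ultimately obtain m where m: "(\<lambda>n. ?hi (u n)) \<longlonglongrightarrow> m" using decseq_convergent by blast
  \<comment> \<open>Both sides are limits of the maxima of \<open>step^j (u (k n)) = u (k n + j)\<close>.\<close>
  have hi_g: "?hi ((step ^^ j) g) = m" for j
  proof (rule LIMSEQ_unique)
    show "(\<lambda>n. ?hi (u (k n + j))) \<longlonglongrightarrow> m"
      using LIMSEQ_subseq_LIMSEQ[OF LIMSEQ_ignore_initial_segment[OF m, of j] k] by (simp add: comp_def)
    show "(\<lambda>n. ?hi (u (k n + j))) \<longlonglongrightarrow> ?hi ((step ^^ j) g)"
    proof (rule LIMSEQ_I)
      fix e :: real assume "0 < e"
      then obtain N where N: "\<And>n x. n \<ge> N \<Longrightarrow> x \<in> K \<Longrightarrow> norm (u (k n) x - g x) < e / 2"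
        using lim[of "e / 2"] by auto
      have "norm (?hi (u (k n + j)) - ?hi ((step ^^ j) g)) < e" if "n \<ge> N" for n
      proof -
        have "\<bar>?hi (u (k n + j)) - ?hi ((step ^^ j) g)\<bar> \<le> e / 2"
          unfolding u_add using N[OF that]
          by (intro hi_diff iter_continuous u_cont g iter_contraction) (auto intro: less_imp_le)
        then show ?thesis using \<open>0 < e\<close> by simp
      qed
      then show "\<exists>N. \<forall>n\<ge>N. norm (?hi (u (k n + j)) - ?hi ((step ^^ j) g)) < e" by blast
    qed
  qed
  have g_le: "g y \<le> m" if "y \<in> K" for y
    using continuous_attains_Sup(2)[OF g that] hi_g[of 0] by simp
  have "\<exists>x\<in>K. (step ^^ j) g x = m" for j
    using continuous_attains_Sup(1)[OF iter_continuous[OF g, of j]] hi_g[of j] by simp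
  then obtain x where x: "\<And>j. x j \<in> K" "\<And>j. (step ^^ j) g (x j) = m" by metis
  have gx: "g (x j ** t) = m" if "t \<in> set_power topological_support j" for j t
    using iter_maximum_principle[OF g g_le x that] .
  have sK: "s \<in> K" using s topological_support_subset by blast
  \<comment> \<open>The maximum is attained on \<open>x j A^j\<close>, which is \<open>z j (s^-j A^j)\<close>.\<close>
  define z where "z j = x j ** matrix_power s j" for j
  have zK: "z j \<in> K" for j by (simp add: z_def mult_mem x power_mem sK)
  obtain w q where w: "w \<in> K" and q: "strict_mono (q :: nat \<Rightarrow> nat)" and zw: "(\<lambda>n. z (q n)) \<longlonglongrightarrow> w"
    using compact_convergent_subsequence[OF compact, of z] zK by blast
  have g_w: "g (w ** y) = m" if y: "y \<in> increments topological_support s i" for y i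
  proof (rule LIMSEQ_unique)
    have yK: "y \<in> K" using y by (simp add: increments_def)
    have "(\<lambda>n. z (q n) ** y) \<longlonglongrightarrow> w ** y" by (intro tendsto_intros zw)
    then show "(\<lambda>n. g (z (q n) ** y)) \<longlonglongrightarrow> g (w ** y)"
      by (rule continuous_on_tendsto_compose[OF g]) (auto simp: mult_mem zK w yK)
    have "eventually (\<lambda>n. g (z (q n) ** y) = m) sequentially"
      using eventually_ge_at_top[of i]
    proof eventually_elim
      case (elim n)
      have "i \<le> q n" using elim seq_suble[OF q, of n] by linarith
      then have "y \<in> increments topological_support s (q n)" using y increments_mono[OF s] by blast
      then show ?case using gx by (simp add: z_def increments_def flip: matrix_mul_assoc)
    qed
    then show "(\<lambda>n. g (z (q n) ** y)) \<longlonglongrightarrow> m" by (rule tendsto_eventually)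
  qed
  have "closed {y \<in> K. g (w ** y) = m}"
    using continuous_closed_preimage_constant[OF continuous_on_left_mult[OF g w] closed] .
  then have "increment_group topological_support s \<subseteq> {y \<in> K. g (w ** y) = m}"
    unfolding increment_group_def using g_w by (intro closure_minimal) (auto simp: increments_def)
  then have "g (w ** (matrix_inv w ** y)) = m" if "y \<in> K" for y
    using dense mult_mem inv_mem w that by blast
  then have g_const: "g y = m" if "y \<in> K" for y
    using that by (simp add: matrix_inv_mult_cancel invertible w)
  show ?thesis
  proof (rule exI[of _ m], intro allI impI)
    fix e :: real assume "0 < e"
    then obtain N where N: "\<And>x. x \<in> K \<Longrightarrow> norm (u (k N) x - g x) < e / 2"
      using lim[of "e / 2"] by auto
    \<comment> \<open>An average of values close to \<open>m\<close> is as close to \<open>m\<close>, so later iterates stay as close as \<open>u (k N)\<close>.\<close>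
    have "\<bar>(step ^^ n) f y - m\<bar> < e" if "n \<ge> k N" "y \<in> K" for n y
    proof -
      have "\<bar>(step ^^ (n - k N)) (u (k N)) y - (step ^^ (n - k N)) (\<lambda>_. m) y\<bar> \<le> e / 2"
        using N g_const that(2) by (intro iter_contraction u_cont) (auto intro: less_imp_le)
      then show ?thesis using \<open>0 < e\<close> u_add[of "k N" "n - k N"] that(1) by (simp add: u_def)
    qed
    then show "\<exists>N. \<forall>n\<ge>N. \<forall>x\<in>K. \<bar>(step ^^ n) f x - m\<bar> < e" by blast
  qed
qed

end

section \<open>Invariant means and algebraicity of compact groups\<close>

context random_walk
begin

lemma iter_left_mult: "(step ^^ n) (\<lambda>y. f (a ** y)) = (\<lambda>x. (step ^^ n) f (a ** x))"
  by (induction n) (auto simp: step_def matrix_mul_assoc)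

definition limit_mean :: "(real^'n^'n \<Rightarrow> real) \<Rightarrow> real" where
  "limit_mean f = lim (\<lambda>n. (step ^^ n) f (mat 1))"

context
  fixes s :: "real^'n^'n"
  assumes s: "s \<in> topological_support" and dense: "K \<subseteq> increment_group topological_support s"
begin

lemma iter_tendsto_limit_mean:
  assumes "continuous_on K f" "x \<in> K"
  shows "(\<lambda>n. (step ^^ n) f x) \<longlonglongrightarrow> limit_mean f"
proof -
  obtain c where c: "\<forall>e>0. \<exists>N. \<forall>n\<ge>N. \<forall>x\<in>K. \<bar>(step ^^ n) f x - c\<bar> < e"
    using iter_converges_uniformly[OF assms(1) s dense] by blast
  have lim: "(\<lambda>n. (step ^^ n) f y) \<longlonglongrightarrow> c" if "y \<in> K" for y
    using c that by (intro LIMSEQ_I) (simp, meson)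
  then have "limit_mean f = c" unfolding limit_mean_def using one_mem by (intro limI) blast
  then show ?thesis using lim[OF assms(2)] by simp
qed

lemma limit_mean_linear:
  assumes "continuous_on K f" "continuous_on K g"
  shows "limit_mean (\<lambda>y. a * f y + b * g y) = a * limit_mean f + b * limit_mean g"
proof (rule LIMSEQ_unique)
  show "(\<lambda>n. (step ^^ n) (\<lambda>y. a * f y + b * g y) (mat 1)) \<longlonglongrightarrow> limit_mean (\<lambda>y. a * f y + b * g y)"
    by (intro iter_tendsto_limit_mean one_mem continuous_intros assms)
  show "(\<lambda>n. (step ^^ n) (\<lambda>y. a * f y + b * g y) (mat 1)) \<longlonglongrightarrow> a * limit_mean f + b * limit_mean g"
    unfolding iter_linear[OF assms one_mem]
    by (intro tendsto_intros iter_tendsto_limit_mean assms one_mem)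
qed

lemma limit_mean_mono:
  assumes "continuous_on K f" "continuous_on K g" "\<And>k. k \<in> K \<Longrightarrow> f k \<le> g k"
  shows "limit_mean f \<le> limit_mean g"
  using iter_tendsto_limit_mean[OF assms(1) one_mem] iter_tendsto_limit_mean[OF assms(2) one_mem]
  by (rule LIMSEQ_le) (use iter_le[OF assms one_mem] in blast)

lemma limit_mean_const: "limit_mean (\<lambda>_. r) = r"
  by (simp add: limit_mean_def)

lemma limit_mean_left_invariant:
  assumes "continuous_on K f" "a \<in> K"
  shows "limit_mean (\<lambda>y. f (a ** y)) = limit_mean f"
proof (rule LIMSEQ_unique)
  show "(\<lambda>n. (step ^^ n) (\<lambda>y. f (a ** y)) (mat 1)) \<longlonglongrightarrow> limit_mean (\<lambda>y. f (a ** y))"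
    by (intro iter_tendsto_limit_mean one_mem continuous_on_left_mult assms)
  show "(\<lambda>n. (step ^^ n) (\<lambda>y. f (a ** y)) (mat 1)) \<longlonglongrightarrow> limit_mean f"
    using iter_tendsto_limit_mean[OF assms] by (simp add: iter_left_mult)
qed

end

end

context compact_matrix_group
begin

text \<open>The law puts geometric weights on the points of a dense sequence. Its increment group is all of \<open>K\<close>,
  so its limit mean is an invariant mean on an arbitrary compact matrix group.\<close>

lemma exists_walk_with_full_support:
  obtains \<mu> where "random_walk K \<mu>" "random_walk.topological_support K \<mu> = K"
proof -
  obtain D where D: "countable D" "D \<subseteq> K" "K \<subseteq> closure D" using separable[of K] by blast
  have ne: "D \<noteq> {}" using D(3) one_mem by auto
  define q where "q = from_nat_into D"
  have q: "q n \<in> K" for n using from_nat_into[OF ne] D(2) by (auto simp: q_def)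
  let ?P = "measure_pmf (geometric_pmf (1/2))"
  define \<mu> where "\<mu> = distr ?P (borel_on K) q"
  have meas: "q \<in> measurable ?P (borel_on K)"
    using q by (auto simp: space_restrict_space)
  have walk: "random_walk K \<mu>"
    unfolding random_walk_def random_walk_axioms_def \<mu>_def
    using compact_matrix_group_axioms meas by (auto intro!: prob_space.prob_space_distr measure_pmf.prob_space_axioms)
  interpret random_walk K \<mu> by (rule walk)
  have "y \<in> topological_support" if y: "y \<in> K" for y
    unfolding topological_support_def
  proof (intro CollectI conjI allI impI y)
    fix e :: real assume "0 < e"
    then obtain d where "d \<in> D" "dist d y < e" using D(3) y closure_approachable by (metis subsetD)
    then obtain n where n: "q n = d" using from_nat_into_surj[OF D(1)] by (auto simp: q_def)
    have "measure \<mu> (ball y e \<inter> K) = measure ?P (q -` (ball y e \<inter> K))"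
      unfolding \<mu>_def using meas by (subst measure_distr) (auto simp: sets_restrict_space)
    also have "\<dots> \<ge> measure ?P {n}"
      using q \<open>dist d y < e\<close> n by (intro measure_pmf.finite_measure_mono) (auto simp: dist_commute)
    also have "measure ?P {n} = pmf (geometric_pmf (1/2)) n" by (simp add: measure_pmf_single)
    finally show "0 < measure \<mu> (ball y e \<inter> K)"
      by (rule less_le_trans[rotated]) simp
  qed
  then have "topological_support = K" using topological_support_subset by blast
  then show thesis using that walk by blast
qed

lemma exists_invariant_mean:
  obtains c :: "(real^'n^'n \<Rightarrow> real) \<Rightarrow> real"
  where "\<And>f g a b. continuous_on K f \<Longrightarrow> continuous_on K g \<Longrightarrow> c (\<lambda>y. a * f y + b * g y) = a * c f + b * c g"
    and "\<And>f g. continuous_on K f \<Longrightarrow> continuous_on K g \<Longrightarrow> (\<And>k. k \<in> K \<Longrightarrow> f k \<le> g k) \<Longrightarrow> c f \<le> c g"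
    and "\<And>r. c (\<lambda>_. r) = r"
    and "\<And>f a. continuous_on K f \<Longrightarrow> a \<in> K \<Longrightarrow> c (\<lambda>y. f (a ** y)) = c f"
proof -
  obtain \<mu> where walk: "random_walk K \<mu>" and full: "random_walk.topological_support K \<mu> = K"
    using exists_walk_with_full_support by blast
  interpret random_walk K \<mu> by (rule walk)
  have s: "mat 1 \<in> topological_support" using full one_mem by simp
  have dense: "K \<subseteq> increment_group topological_support (mat 1)"
    using subset_coset_increment_group[OF topological_support_subset s] full by (auto simp: matrix_inv_one)
  note lim = limit_mean_linear[OF s dense] limit_mean_mono[OF s dense]
    limit_mean_left_invariant[OF s dense]
  show thesis by (rule that[of limit_mean]) (auto intro: lim limit_mean_const[OF s dense])
qed

end

text \<open>Finite sums of products \<open>a x * b y\<close>. In this form one integrates over \<open>y\<close> by applying a linear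
  functional to the factors \<open>b\<close>, and the result is visibly a polynomial in \<open>x\<close>.\<close>

inductive separated_polynomial :: "('a::real_normed_vector \<Rightarrow> 'b::real_normed_vector \<Rightarrow> real) \<Rightarrow> bool" where
  tensor: "real_polynomial_function a \<Longrightarrow> real_polynomial_function b \<Longrightarrow> separated_polynomial (\<lambda>x y. a x * b y)"
| add: "separated_polynomial F \<Longrightarrow> separated_polynomial H \<Longrightarrow> separated_polynomial (\<lambda>x y. F x y + H x y)"

lemma separated_polynomial_mult_tensor:
  "separated_polynomial F \<Longrightarrow> real_polynomial_function a \<Longrightarrow> real_polynomial_function b
    \<Longrightarrow> separated_polynomial (\<lambda>x y. F x y * (a x * b y))"
proof (induction rule: separated_polynomial.induct)
  case (tensor c d)
  then have "separated_polynomial (\<lambda>x y. (c x * a x) * (d y * b y))"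
    by (intro separated_polynomial.tensor real_polynomial_function.intros(4))
  then show ?case by (simp add: mult_ac)
next
  case (add F H)
  then show ?case by (simp add: distrib_right separated_polynomial.add)
qed

lemma separated_polynomial_mult:
  assumes "separated_polynomial H" "separated_polynomial F"
  shows "separated_polynomial (\<lambda>x y. F x y * H x y)"
  using assms
  by (induction rule: separated_polynomial.induct)
    (auto intro: separated_polynomial_mult_tensor separated_polynomial.add simp: distrib_left)

lemma separated_polynomial_sum:
  "finite I \<Longrightarrow> (\<And>i. i \<in> I \<Longrightarrow> separated_polynomial (F i)) \<Longrightarrow> separated_polynomial (\<lambda>x y. \<Sum>i\<in>I. F i x y)"
proof (induction rule: finite_induct)
  case empty
  have "separated_polynomial (\<lambda>x y. (\<lambda>_. 0) x * (\<lambda>_. 0) y)"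
    by (intro separated_polynomial.tensor real_polynomial_function.intros(2))
  then show ?case by simp
next
  case (insert i I)
  then show ?case by (auto intro: separated_polynomial.add)
qed

lemma polynomial_of_product_separated:
  fixes p :: "real^'n^'n \<Rightarrow> real"
  assumes "real_polynomial_function p"
  shows "separated_polynomial (\<lambda>(x :: real^'n^'n) (y :: real^'n^'n). p (x ** y))"
  using assms
proof (induction rule: real_polynomial_function.induct)
  case (linear f)
  interpret f: bounded_linear f by fact
  have lin: "linear (\<lambda>x. f (x ** y))" and lin': "linear (\<lambda>y. f (x ** y))"
    for x y :: "real^'n^'n"
  proof -
    have "linear (\<lambda>x :: real^'n^'n. x ** y)" "linear (\<lambda>y :: real^'n^'n. x ** y)"
      by (auto intro!: linearI simp: vec_eq_iff matrix_matrix_mult_def algebra_simps sum.distrib sum_distrib_left)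
    then show "linear (\<lambda>x. f (x ** y))" "linear (\<lambda>y. f (x ** y))"
      using linear_compose[OF _ f.linear] by (auto simp: comp_def)
  qed
  \<comment> \<open>A linear function of the product is expanded in the coordinates of the left factor.\<close>
  have eq: "f (x ** y) = (\<Sum>b\<in>Basis. (x \<bullet> b) * f (b ** y))"
    for x y :: "real^'n^'n"
  proof -
    have "f (x ** y) = f ((\<Sum>b\<in>Basis. (x \<bullet> b) *\<^sub>R b) ** y)" by (simp add: euclidean_representation)
    also have "\<dots> = (\<Sum>b\<in>Basis. f (((x \<bullet> b) *\<^sub>R b) ** y))" by (rule linear_sum[OF lin])
    also have "\<dots> = (\<Sum>b\<in>Basis. (x \<bullet> b) * f (b ** y))"
      using linear_scale[OF lin] by simp
    finally show ?thesis .
  qed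
  have blin: "bounded_linear (\<lambda>y. f (b ** y))" for b :: "real^'n^'n"
    using lin' by (simp add: linear_conv_bounded_linear)
  have "separated_polynomial (\<lambda>(x :: real^'n^'n) (y :: real^'n^'n). \<Sum>b\<in>Basis. (x \<bullet> b) * f (b ** y))"
    by (intro separated_polynomial_sum finite_Basis separated_polynomial.tensor
        real_polynomial_function.intros(1) bounded_linear_inner_left blin)
  moreover have "(\<lambda>(x :: real^'n^'n) (y :: real^'n^'n). \<Sum>b\<in>Basis. (x \<bullet> b) * f (b ** y))
      = (\<lambda>x y. f (x ** y))"
    by (intro ext eq[symmetric])
  ultimately show ?case by simp
next
  case (const c)
  have "separated_polynomial (\<lambda>x y. (\<lambda>_. c) x * (\<lambda>_. 1) y)"
    by (intro separated_polynomial.tensor real_polynomial_function.intros(2))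
  then show ?case by simp
qed (auto intro: separated_polynomial.add separated_polynomial_mult)

lemma continuous_on_real_polynomial: "real_polynomial_function p \<Longrightarrow> continuous_on S p"
  using continuous_real_polymonial_function continuous_at_imp_continuous_on by blast

text \<open>For \<open>A\<close> outside \<open>K\<close> the compact sets \<open>K\<close> and \<open>A K\<close> are disjoint, so some polynomial \<open>p\<close> is close to
  \<open>0\<close> on \<open>K\<close> and close to \<open>1\<close> on \<open>A K\<close>. Its average \<open>x \<mapsto> mean of p (x k) over k\<close> is again a polynomial. It is
  constant on \<open>K\<close> by invariance, and takes a different value at \<open>A\<close>.\<close>

theorem (in compact_matrix_group) zariski_closed: "zariski_closed K"
proof -
  obtain c :: "(real^'n^'n \<Rightarrow> real) \<Rightarrow> real"
    where c_lin: "\<And>f g a b. continuous_on K f \<Longrightarrow> continuous_on K g \<Longrightarrow> c (\<lambda>y. a * f y + b * g y) = a * c f + b * c g"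
    and c_mono: "\<And>f g. continuous_on K f \<Longrightarrow> continuous_on K g \<Longrightarrow> (\<And>k. k \<in> K \<Longrightarrow> f k \<le> g k) \<Longrightarrow> c f \<le> c g"
    and c_const: "\<And>r. c (\<lambda>_. r) = r"
    and c_inv: "\<And>f a. continuous_on K f \<Longrightarrow> a \<in> K \<Longrightarrow> c (\<lambda>y. f (a ** y)) = c f"
    using exists_invariant_mean by blast
  have average_polynomial: "(\<forall>x. continuous_on K (F x)) \<and> real_polynomial_function (\<lambda>x. c (F x))"
    if "separated_polynomial F" for F :: "real^'n^'n \<Rightarrow> real^'n^'n \<Rightarrow> real"
    using that
  proof (induction rule: separated_polynomial.induct)
    case (tensor a b)
    note cont = continuous_on_real_polynomial[OF tensor(2), of K]
    have "c (\<lambda>y. a x * b y) = a x * c b" for x using c_lin[OF cont cont, of "a x" 0] by simp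
    then show ?case using tensor cont by (auto intro!: continuous_intros)
  next
    case (add F H)
    then have "c (\<lambda>y. F x y + H x y) = c (F x) + c (H x)" for x using c_lin[of "F x" "H x" 1 1] by simp
    then show ?case using add by (auto intro: continuous_intros)
  qed
  define P where "P = {p. real_polynomial_function p \<and> (\<forall>k\<in>K. p k = 0)}"
  have "A \<in> K" if A: "invertible A" "\<forall>p\<in>P. p A = 0" for A
  proof (rule ccontr)
    assume "A \<notin> K"
    let ?AK = "(\<lambda>k. A ** k) ` K"
    have "compact ?AK" by (intro compact_continuous_image compact continuous_intros)
    have disj: "K \<inter> ?AK = {}"
    proof -
      have False if "k \<in> K" "A ** k \<in> K" for k
        using mult_mem[OF that(2) inv_mem[OF that(1)]] \<open>A \<notin> K\<close> that
        by (simp add: matrix_inv_mult_cancel invertible)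
      then show ?thesis by blast
    qed
    obtain f :: "real^'n^'n \<Rightarrow> real" where f: "continuous_on UNIV f"
      "\<And>x. f x = 0 \<longleftrightarrow> x \<in> K" "\<And>x. f x = 1 \<longleftrightarrow> x \<in> ?AK"
      using Urysohn_strong[OF closed compact_imp_closed[OF \<open>compact ?AK\<close>] disj zero_neq_one]
      by metis
    obtain p where p: "real_polynomial_function p" "\<And>x. x \<in> K \<union> ?AK \<Longrightarrow> \<bar>f x - p x\<bar> < 1/3"
      using Stone_Weierstrass_real_polynomial_function[of "K \<union> ?AK" f "1/3"]
        compact_Un[OF compact \<open>compact ?AK\<close>] continuous_on_subset[OF f(1)] by auto
    \<comment> \<open>The averaged polynomial, shifted to vanish on \<open>K\<close>.\<close>
    define r where "r x = c (\<lambda>k. p (x ** k)) - c p" for x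
    have cont: "continuous_on K (\<lambda>k. p (z ** k))"
      and avg: "real_polynomial_function (\<lambda>x. c (\<lambda>k. p (x ** k)))" for z
      using average_polynomial[OF polynomial_of_product_separated[OF p(1)]] by auto
    have cont_p: "continuous_on K p" by (rule continuous_on_real_polynomial[OF p(1)])
    have "real_polynomial_function r" unfolding r_def
      by (intro real_polynomial_function_diff avg real_polynomial_function.intros(2))
    then have "r \<in> P" using c_inv[OF cont_p] by (auto simp: P_def r_def)
    then have "c (\<lambda>k. p (A ** k)) = c p" using A(2) by (auto simp: r_def)
    moreover have "c p \<le> 1/3"
    proof -
      have "p k \<le> 1/3" if "k \<in> K" for k using p(2)[of k] f(2)[of k] that by auto
      then show ?thesis using c_mono[OF cont_p continuous_on_const, of "1/3"] c_const by simp
    qed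
    moreover have "2/3 \<le> c (\<lambda>k. p (A ** k))"
    proof -
      have "2/3 \<le> p (A ** k)" if "k \<in> K" for k
      proof -
        have "\<bar>1 - p (A ** k)\<bar> < 1/3" using p(2)[of "A ** k"] f(3)[of "A ** k"] that by auto
        then show ?thesis by linarith
      qed
      then show ?thesis using c_mono[OF continuous_on_const cont, of "2/3" A] c_const by simp
    qed
    ultimately show False by simp
  qed
  then have "K = {A. invertible A \<and> (\<forall>p\<in>P. p A = 0)}" using invertible by (auto simp: P_def)
  then show ?thesis unfolding zariski_closed_def by (intro exI[of _ P]) (auto simp: P_def)
qed

section \<open>Random variables with prescribed laws\<close>

text \<open>Truncating \<open>1/2 - cos (pi t)\<close> gives a continuous function of period \<open>2\<close> with value \<open>0\<close> on \<open>[0, 1/3]\<close> and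
  value \<open>1\<close> on \<open>[2/3, 1]\<close>. It reads off the first ternary digit of a point of the Cantor set.\<close>

definition ramp :: "real \<Rightarrow> real" where
  "ramp t = max 0 (min 1 (1/2 - cos (pi * t)))"

definition cantor :: "(nat \<Rightarrow> bool) \<Rightarrow> real" where
  "cantor b = (\<Sum>m. 2 * of_bool (b m) / 3 ^ Suc m)"

lemma ramp_nonneg: "0 \<le> ramp t" and ramp_le_one: "ramp t \<le> 1"
  by (auto simp: ramp_def)

lemma continuous_on_ramp: "continuous_on A ramp"
  unfolding ramp_def by (intro continuous_intros)

lemma ramp_add_even: "ramp (2 * of_nat n + t) = ramp t"
proof -
  have "pi * (2 * real n + t) = pi * t + 2 * real n * pi" by (simp add: algebra_simps)
  moreover have "cos (2 * real n * pi) = 1" "sin (2 * real n * pi) = 0"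
    using cos_2npi[of n] sin_2npi[of n] by simp_all
  ultimately have "cos (pi * (2 * real n + t)) = cos (pi * t)" by (simp only: cos_add)
  then show ?thesis by (simp add: ramp_def)
qed

lemma ramp_eq_0: assumes "0 \<le> t" "t \<le> 1/3" shows "ramp t = 0"
proof -
  have "pi * t \<le> pi / 3" using assms(2) mult_left_mono[of t "1/3" pi] by simp
  then have "cos (pi / 3) \<le> cos (pi * t)" using assms by (intro cos_monotone_0_pi_le) auto
  then show ?thesis by (simp add: ramp_def cos_60)
qed

lemma ramp_eq_1: assumes "2/3 \<le> t" "t \<le> 1" shows "ramp t = 1"
proof -
  have "2 * pi / 3 \<le> pi * t" using assms(1) mult_left_mono[of "2/3" t pi] by simp
  then have "cos (pi * t) \<le> cos (2 * pi / 3)" using assms by (intro cos_monotone_0_pi_le) auto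
  moreover have "cos (2 * pi / 3) = - (1/2)"
    using cos_double_cos[of "pi / 3"] by (simp add: cos_60 power2_eq_square)
  ultimately show ?thesis by (simp add: ramp_def)
qed

lemma summable_cantor: "summable (\<lambda>m. 2 * of_bool (b m) / 3 ^ Suc m :: real)"
proof (rule summable_comparison_test)
  show "\<exists>N. \<forall>m\<ge>N. norm (2 * of_bool (b m) / 3 ^ Suc m :: real) \<le> 2/3 * (1/3) ^ m"
    by (simp add: power_one_over of_bool_def)
  show "summable (\<lambda>m. 2/3 * (1/3) ^ m :: real)"
    by (intro summable_mult summable_geometric) simp
qed

lemma cantor_shift: "cantor b = (2 * of_bool (b 0) + cantor (\<lambda>m. b (Suc m))) / 3"
proof -
  have "cantor b = 2 * of_bool (b 0) / 3 + (\<Sum>m. 2 * of_bool (b (Suc m)) / 3 ^ Suc (Suc m))"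
    unfolding cantor_def using suminf_split_head[OF summable_cantor, of b] by simp
  also have "(\<Sum>m. 2 * of_bool (b (Suc m)) / 3 ^ Suc (Suc m)) = cantor (\<lambda>m. b (Suc m)) / 3"
    unfolding cantor_def by (subst suminf_divide[OF summable_cantor, symmetric]) (simp add: field_simps)
  finally show ?thesis by (simp add: add_divide_distrib)
qed

lemma cantor_nonneg: "0 \<le> cantor b"
  unfolding cantor_def by (intro suminf_nonneg summable_cantor) auto

lemma cantor_le_one: "cantor b \<le> 1"
proof -
  have geo: "(\<lambda>m. 2/3 * (1/3) ^ m :: real) sums (2/3 * (1 / (1 - 1/3)))"
    by (intro sums_mult geometric_sums) simp
  have "cantor b \<le> (\<Sum>m. 2/3 * (1/3) ^ m :: real)"
    unfolding cantor_def
    by (intro suminf_le summable_cantor sums_summable[OF geo]) (auto simp: power_one_over of_bool_def)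
  also have "\<dots> = 1" using sums_unique[OF geo] by simp
  finally show ?thesis .
qed

text \<open>Multiplication by \<open>3 ^ k\<close> shifts the ternary digits. The digits moved in front of the point are all \<open>0\<close> or
  \<open>2\<close>, so they contribute an even integer, which is a period of \<open>ramp\<close>.\<close>

lemma ramp_cantor: "ramp (3 ^ k * cantor b) = of_bool (b k)"
proof (induction k arbitrary: b)
  case 0
  have "ramp ((2 * of_bool (b 0) + cantor (\<lambda>m. b (Suc m))) / 3) = of_bool (b 0)"
    using cantor_nonneg[of "\<lambda>m. b (Suc m)"] cantor_le_one[of "\<lambda>m. b (Suc m)"]
    by (cases "b 0") (auto intro!: ramp_eq_0 ramp_eq_1)
  then show ?case by (simp only: power_0 mult_1 cantor_shift[of b])
next
  case (Suc k)
  have "3 ^ Suc k * cantor b = 2 * of_nat (3 ^ k * of_bool (b 0)) + 3 ^ k * cantor (\<lambda>m. b (Suc m))"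
    by (subst cantor_shift) (simp add: algebra_simps)
  then show ?case using Suc.IH[of "\<lambda>m. b (Suc m)"] by (simp only: ramp_add_even)
qed

lemma binary_expansion:
  fixes x :: real
  assumes "0 \<le> x" "x < 1"
  shows "(\<lambda>n. of_bool (odd \<lfloor>2 ^ Suc n * x\<rfloor>) / 2 ^ Suc n) sums x"
proof -
  have partial: "(\<Sum>n<N. of_bool (odd \<lfloor>2 ^ Suc n * x\<rfloor>) / 2 ^ Suc n) = \<lfloor>2 ^ N * x\<rfloor> / 2 ^ N" for N
  proof (induction N)
    case 0
    have "\<lfloor>x\<rfloor> = 0" using assms by linarith
    then show ?case by simp
  next
    case (Suc N)
    let ?y = "2 ^ N * x"
    have "\<lfloor>2 * ?y\<rfloor> div 2 = \<lfloor>?y\<rfloor>"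
      using floor_divide_real_eq_div[of 2 "2 * ?y"] by simp
    then have "\<lfloor>2 * ?y\<rfloor> = 2 * \<lfloor>?y\<rfloor> + of_bool (odd \<lfloor>2 * ?y\<rfloor>)"
      by (metis mult_div_mod_eq mod2_eq_if of_bool_def)
    then have "real_of_int \<lfloor>2 * ?y\<rfloor> = 2 * \<lfloor>?y\<rfloor> + of_bool (odd \<lfloor>2 * ?y\<rfloor>)" by (metis of_int_add of_int_mult of_int_numeral of_int_of_bool)
    then show ?case using Suc by (simp add: field_simps)
  qed
  have "(\<lambda>N. \<lfloor>2 ^ N * x\<rfloor> / 2 ^ N) \<longlonglongrightarrow> x"
  proof (rule tendsto_sandwich[of "\<lambda>N. x - (1/2) ^ N" _ _ "\<lambda>_. x"])
    have "(\<lambda>N. x - (1/2) ^ N) \<longlonglongrightarrow> x - 0" by (intro tendsto_intros LIMSEQ_power_zero) simp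
    then show "(\<lambda>N. x - (1/2) ^ N) \<longlonglongrightarrow> x" by simp
    have "x - (1/2) ^ N \<le> \<lfloor>2 ^ N * x\<rfloor> / 2 ^ N" for N
    proof -
      have "(2 ^ N * x - 1) / 2 ^ N \<le> \<lfloor>2 ^ N * x\<rfloor> / 2 ^ N" by (rule divide_right_mono) (linarith, simp)
      then show ?thesis by (simp add: field_simps power_one_over)
    qed
    then show "eventually (\<lambda>N. x - (1/2) ^ N \<le> \<lfloor>2 ^ N * x\<rfloor> / 2 ^ N) sequentially" by simp
    have "\<lfloor>2 ^ N * x\<rfloor> / 2 ^ N \<le> x" for N by (simp add: field_simps)
    then show "eventually (\<lambda>N. \<lfloor>2 ^ N * x\<rfloor> / 2 ^ N \<le> x) sequentially" by simp
  qed simp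
  then show ?thesis unfolding sums_def partial .
qed

text \<open>Schoenberg's curve. Its coordinates are the series \<open>ramp (3 ^ m t) / 2 ^ (n + 1)\<close> over disjoint
  subsequences of indices \<open>m\<close>, which makes continuity a matter of uniform convergence. The binary
  digits of all coordinates of a point, interleaved into one sequence and read as ternary digits \<open>0\<close> and
  \<open>2\<close>, give a parameter that the curve maps to that point; this is the Borel section \<open>\<psi>\<close>.\<close>

lemma space_filling_curve:
  fixes S :: "'a::euclidean_space set"
  assumes "bounded S"
  obtains \<phi> :: "real \<Rightarrow> 'a" and \<psi> :: "'a \<Rightarrow> real"
  where "continuous_on UNIV \<phi>" "\<psi> \<in> borel_measurable borel" "\<And>x. \<psi> x \<in> {0..1}"
    "\<And>x. x \<in> S \<Longrightarrow> \<phi> (\<psi> x) = x"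
proof -
  obtain R where R: "0 < R" "\<And>x. x \<in> S \<Longrightarrow> norm x < R"
    using assms bounded_pos_less by blast
  define code where "code b n = prod_encode (to_nat_on Basis b, n)" for b :: 'a and n
  \<comment> \<open>The coordinates of points of \<open>S\<close>, rescaled from \<open>]-R, R[\<close> to the unit interval.\<close>
  define coord where "coord b x = (x \<bullet> b + R) / (2 * R)" for b x :: 'a
  define digit where "digit x m = (case prod_decode m of (i, n) \<Rightarrow>
      odd \<lfloor>2 ^ Suc n * coord (from_nat_into Basis i) x\<rfloor>)" for x :: 'a and m
  define \<psi> where "\<psi> x = cantor (digit x)" for x
  define \<phi> where "\<phi> t = (\<Sum>b\<in>Basis. (2 * R * (\<Sum>n. ramp (3 ^ code b n * t) / 2 ^ Suc n) - R) *\<^sub>R b)" for t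
  have "continuous_on UNIV (\<lambda>t. \<Sum>n. ramp (3 ^ code b n * t) / 2 ^ Suc n)" for b
  proof (rule uniform_limit_theorem)
    show "uniform_limit UNIV (\<lambda>N t. \<Sum>n<N. ramp (3 ^ code b n * t) / 2 ^ Suc n)
        (\<lambda>t. \<Sum>n. ramp (3 ^ code b n * t) / 2 ^ Suc n) sequentially"
    proof (rule Weierstrass_m_test)
      show "norm (ramp (3 ^ code b n * t) / 2 ^ Suc n) \<le> (1/2) ^ Suc n" for n t
        using ramp_nonneg ramp_le_one by (simp add: power_one_over divide_right_mono)
      show "summable (\<lambda>n. (1/2::real) ^ Suc n)" by (subst summable_Suc_iff) (simp add: summable_geometric)
    qed
  qed (auto intro!: always_eventually continuous_intros continuous_on_compose2[OF continuous_on_ramp[of UNIV]])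
  then have "continuous_on UNIV \<phi>" unfolding \<phi>_def by (intro continuous_intros)
  moreover have "\<psi> \<in> borel_measurable borel"
  proof -
    have "(\<lambda>x. of_bool (odd \<lfloor>2 ^ Suc n * coord b x\<rfloor>) :: real) \<in> borel_measurable borel" for n b
      unfolding coord_def of_bool_def by measurable
    then have "(\<lambda>x. of_bool (digit x m) :: real) \<in> borel_measurable borel" for m
      unfolding digit_def by (cases "prod_decode m") simp
    then show ?thesis unfolding \<psi>_def cantor_def by measurable
  qed
  moreover have "\<psi> x \<in> {0..1}" for x
    by (simp add: \<psi>_def cantor_nonneg cantor_le_one)
  moreover have "\<phi> (\<psi> x) = x" if x: "x \<in> S" for x
  proof -
    have "(2 * R * (\<Sum>n. ramp (3 ^ code b n * \<psi> x) / 2 ^ Suc n) - R) = x \<bullet> b" if b: "b \<in> Basis" for b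
    proof -
      have "\<bar>x \<bullet> b\<bar> < R" using R(2)[OF x] Basis_le_norm[OF b, of x] by simp
      then have c: "0 \<le> coord b x" "coord b x < 1" using R(1) by (auto simp: coord_def field_simps)
      have "from_nat_into Basis (to_nat_on Basis b) = b"
        using b by (simp add: countable_finite from_nat_into_to_nat_on)
      then have "ramp (3 ^ code b n * \<psi> x) = of_bool (odd \<lfloor>2 ^ Suc n * coord b x\<rfloor>)" for n
        by (simp add: \<psi>_def ramp_cantor digit_def code_def)
      then have "(\<Sum>n. ramp (3 ^ code b n * \<psi> x) / 2 ^ Suc n) = coord b x"
        using sums_unique[OF binary_expansion[OF c]] by simp
      then show ?thesis using R(1) by (simp add: coord_def field_simps)
    qed
    then have "\<phi> (\<psi> x) = (\<Sum>b\<in>Basis. (x \<bullet> b) *\<^sub>R b)" unfolding \<phi>_def by (intro sum.cong) auto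
    then show ?thesis by (simp add: euclidean_representation)
  qed
  ultimately show thesis using that by blast
qed

context prob_space
begin

text \<open>The set where a continuous distribution function is at most \<open>p\<close> is a half-line ending at a point where
  the function equals \<open>p\<close>.\<close>

lemma cdf_of_continuous_law_uniform:
  fixes W :: "'a \<Rightarrow> real"
  assumes W: "random_variable borel W" and atomless: "\<And>w. prob {\<omega> \<in> space M. W \<omega> = w} = 0"
    and p: "0 < p" "p < 1"
  shows "prob {\<omega> \<in> space M. cdf (distr M borel W) (W \<omega>) \<le> p} = p"
proof -
  let ?D = "distr M borel W"
  interpret D: real_distribution ?D using W by simp
  have "measure ?D {x} = 0" for x
  proof -
    have "W -` {x} \<inter> space M = {\<omega> \<in> space M. W \<omega> = x}" by auto
    then show ?thesis using atomless[of x] W by (simp add: measure_distr)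
  qed
  then have cont: "isCont (cdf ?D) x" for x
    by (simp add: D.isCont_cdf)
  have "eventually (\<lambda>x. cdf ?D x < p) at_bot" "eventually (\<lambda>x. p < cdf ?D x) at_top"
    using order_tendstoD(2)[OF D.cdf_lim_at_bot p(1)] order_tendstoD(1)[OF D.cdf_lim_at_top_prob p(2)] by auto
  then obtain a b where a: "cdf ?D a < p" and b: "p < cdf ?D b"
    using eventually_happens'[OF trivial_limit_at_bot_linorder] eventually_happens'[OF trivial_limit_at_top_linorder]
    by metis
  define S where "S = {x. cdf ?D x \<le> p}"
  have S_le: "x \<le> b" if "x \<in> S" for x
    using that b D.cdf_nondecreasing[of b x] by (auto simp: S_def) (meson linorder_not_le order.strict_implies_order order_trans leD)
  have S_bdd: "bdd_above S" using S_le by (auto simp: bdd_above_def)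
  have "a \<in> S" using a by (simp add: S_def)
  have "closed S" unfolding S_def
    using cont by (intro closed_Collect_le continuous_intros) (auto simp: continuous_on_eq_continuous_at)
  define v where "v = Sup S"
  have v: "v \<in> S" unfolding v_def using closed_contains_Sup[OF _ S_bdd \<open>closed S\<close>] \<open>a \<in> S\<close> by blast
  have S_eq: "S = {..v}"
    using v cSup_upper[OF _ S_bdd] D.cdf_nondecreasing[of _ v] by (force simp: v_def S_def)
  have "cdf ?D v = p"
  proof (rule ccontr)
    assume "cdf ?D v \<noteq> p"
    then have lt: "cdf ?D v < p" using v by (simp add: S_def)
    have "v \<le> b" using S_le v by blast
    then obtain z where "v \<le> z" "cdf ?D z = p"
      using IVT'[of "cdf ?D" v p b] lt b cont by (auto simp: continuous_at_imp_continuous_on)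
    then show False using S_eq lt unfolding S_def by force
  qed
  moreover have "prob {\<omega> \<in> space M. cdf ?D (W \<omega>) \<le> p} = cdf ?D v"
  proof -
    have "{\<omega> \<in> space M. cdf ?D (W \<omega>) \<le> p} = W -` {..v} \<inter> space M"
      using S_eq unfolding S_def by auto
    then show ?thesis using W by (simp add: cdf_def measure_distr)
  qed
  ultimately show ?thesis by simp
qed

text \<open>The distribution function of \<open>W\<close>, evaluated at \<open>W\<close>, is uniform on the unit interval; composing it
  with the quantile function of \<open>\<rho>\<close> gives a variable with law \<open>\<rho>\<close>.\<close>

lemma exists_real_law:
  fixes W :: "'a \<Rightarrow> real"
  assumes W: "random_variable borel W" and atomless: "\<And>w. prob {\<omega> \<in> space M. W \<omega> = w} = 0"
    and \<rho>: "real_distribution \<rho>"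
  obtains V where "random_variable borel V" "distr M borel V = \<rho>"
proof -
  interpret \<rho>: cdf_distribution \<rho> unfolding cdf_distribution_def by (rule \<rho>)
  interpret W: real_distribution "distr M borel W" using W by simp
  interpret W: cdf_distribution "distr M borel W" by (rule cdf_distribution.intro) (rule W.real_distribution_axioms)
  define U where "U \<omega> = cdf (distr M borel W) (W \<omega>)" for \<omega>
  have U[measurable]: "random_variable borel U"
    unfolding U_def by (rule measurable_compose[OF W W.measurable_C])
  have U_law: "prob {\<omega> \<in> space M. U \<omega> \<le> p} = p" if "0 < p" "p < 1" for p
    unfolding U_def by (rule cdf_of_continuous_law_uniform[OF W atomless that])
  have U_nonneg: "0 \<le> U \<omega>" and U_le: "U \<omega> \<le> 1" for \<omega>
    unfolding U_def by (rule W.cdf_nonneg) (rule W.cdf_bounded_prob)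
  have U0: "prob {\<omega> \<in> space M. U \<omega> \<le> 0} = 0"
  proof (rule antisym[OF field_le_epsilon])
    fix e :: real assume "0 < e"
    define p where "p = min e (1/2)"
    have "prob {\<omega> \<in> space M. U \<omega> \<le> 0} \<le> prob {\<omega> \<in> space M. U \<omega> \<le> p}"
      using \<open>0 < e\<close> by (intro finite_measure_mono) (auto simp: p_def)
    also have "\<dots> = p" using \<open>0 < e\<close> by (intro U_law) (auto simp: p_def)
    finally show "prob {\<omega> \<in> space M. U \<omega> \<le> 0} \<le> 0 + e" by (simp add: p_def)
  qed simp
  have U1: "prob {\<omega> \<in> space M. 1 \<le> U \<omega>} = 0"
  proof (rule antisym[OF field_le_epsilon])
    fix e :: real assume "0 < e"
    define p where "p = max (1 - e) (1/2)"
    have p: "0 < p" "p < 1" using \<open>0 < e\<close> by (auto simp: p_def)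
    have "prob {\<omega> \<in> space M. 1 \<le> U \<omega>} \<le> prob (space M - {\<omega> \<in> space M. U \<omega> \<le> p})"
      using p by (intro finite_measure_mono) auto
    also have "\<dots> = 1 - p" using U_law[OF p] by (subst prob_compl) auto
    finally show "prob {\<omega> \<in> space M. 1 \<le> U \<omega>} \<le> 0 + e" by (simp add: p_def)
  qed simp
  have AE_U: "AE \<omega> in M. U \<omega> \<in> {0<..<1}"
  proof -
    have "{\<omega> \<in> space M. U \<omega> \<le> 0} \<in> null_sets M" "{\<omega> \<in> space M. 1 \<le> U \<omega>} \<in> null_sets M"
      using U0 U1 by (auto simp: null_sets_def emeasure_eq_measure)
    from AE_not_in[OF this(1)] AE_not_in[OF this(2)] AE_space show ?thesis by eventually_elim auto
  qed
  \<comment> \<open>The quantile function, set to \<open>0\<close> outside the open unit interval, where it is meaningless.\<close>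
  define J where "J u = \<rho>.I u * indicator {0<..<1} u" for u
  have J[measurable]: "J \<in> borel_measurable borel"
    using \<rho>.measurable_CI unfolding J_def
    by (subst (asm) borel_measurable_restrict_space_iff) (auto simp: mult.commute)
  define V where "V \<omega> = J (U \<omega>)" for \<omega>
  have V[measurable]: "random_variable borel V" unfolding V_def by measurable
  interpret V: real_distribution "distr M borel V" using V by simp
  have "cdf (distr M borel V) x = cdf \<rho> x" for x
  proof -
    let ?p = "cdf \<rho> x"
    have "cdf (distr M borel V) x = prob {\<omega> \<in> space M. V \<omega> \<le> x}"
    proof -
      have "V -` {..x} \<inter> space M = {\<omega> \<in> space M. V \<omega> \<le> x}" by auto
      then show ?thesis using V by (simp add: cdf_def measure_distr)
    qed
    also have "\<dots> = prob {\<omega> \<in> space M. U \<omega> \<le> ?p}"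
    proof (rule finite_measure_eq_AE)
      show "AE \<omega> in M. (\<omega> \<in> {\<omega> \<in> space M. V \<omega> \<le> x}) = (\<omega> \<in> {\<omega> \<in> space M. U \<omega> \<le> ?p})"
        using AE_U by eventually_elim (simp add: V_def J_def \<rho>.pseudoinverse[symmetric])
    qed measurable
    also have "\<dots> = ?p"
    proof -
      have "0 \<le> ?p" "?p \<le> 1" by (rule \<rho>.cdf_nonneg) (rule \<rho>.cdf_bounded_prob)
      then consider "?p = 0" | "0 < ?p" "?p < 1" | "?p = 1" by linarith
      then show ?thesis using U_law[of ?p] U0 U_le by cases (auto simp: prob_space)
    qed
    finally show ?thesis .
  qed
  then have "distr M borel V = \<rho>"
    by (intro cdf_unique V.real_distribution_axioms \<rho> ext)
  then show thesis using that V by blast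
qed

text \<open>Sequential compactness of laws on a compact set, with the limit realized on the same probability space.
  The section of the space-filling curve turns the variables into real ones with values in the unit
  interval, where Helly's theorem applies; the curve itself, being continuous, carries the weak limit back.\<close>

lemma weak_limit_of_subsequence:
  fixes K :: "'b::euclidean_space set" and W :: "'a \<Rightarrow> real"
  assumes K: "compact K" "K \<noteq> {}" and Y: "\<And>n. random_variable (borel_on K) (Y n)"
    and W: "random_variable borel W" and atomless: "\<And>w. prob {\<omega> \<in> space M. W \<omega> = w} = 0"
  obtains \<eta> r where "random_variable (borel_on K) \<eta>" "strict_mono (r :: nat \<Rightarrow> nat)"
    "\<And>f :: 'b \<Rightarrow> real. continuous_on K f \<Longrightarrow> (\<lambda>n. expectation (\<lambda>\<omega>. f (Y (r n) \<omega>))) \<longlonglongrightarrow> expectation (\<lambda>\<omega>. f (\<eta> \<omega>))"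
proof -
  obtain \<phi> :: "real \<Rightarrow> 'b" and \<psi> :: "'b \<Rightarrow> real" where \<phi>: "continuous_on UNIV \<phi>"
    and \<psi>[measurable]: "\<psi> \<in> borel_measurable borel" and \<psi>_range: "\<And>x. \<psi> x \<in> {0..1}"
    and \<phi>\<psi>: "\<And>x. x \<in> K \<Longrightarrow> \<phi> (\<psi> x) = x"
    using space_filling_curve[OF compact_imp_bounded[OF K(1)]] by blast
  have Y_K: "Y n \<omega> \<in> K" if "\<omega> \<in> space M" for n \<omega>
    using measurable_space[OF Y that] by (simp add: space_restrict_space)
  have Y_borel[measurable]: "random_variable borel (Y n)" for n
    using Y[of n] by (simp add: measurable_restrict_space2_iff)
  have \<phi>_borel[measurable]: "\<phi> \<in> borel_measurable borel"
    by (rule borel_measurable_continuous_onI[OF \<phi>])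
  define law where "law n = distr M borel (\<lambda>\<omega>. \<psi> (Y n \<omega>))" for n
  have law: "real_distribution (law n)" for n unfolding law_def by (intro real_distribution_distr) measurable
  have "measure (law n) {-1<..1} = 1" for n
  proof -
    have "(\<lambda>\<omega>. \<psi> (Y n \<omega>)) -` {-1<..1} \<inter> space M = space M"
      using \<psi>_range by (auto simp: less_le_trans[of "-1" 0])
    then show ?thesis by (simp add: law_def measure_distr prob_space)
  qed
  then have "\<exists>a b. a < b \<and> (\<forall>n. measure (law n) {a<..b} > 1 - e)" if "0 < e" for e
    using that by (intro exI[of _ "-1"] exI[of _ 1]) simp
  then have "tight law" unfolding tight_def using law by blast
  then obtain r \<rho> where r: "strict_mono (r :: nat \<Rightarrow> nat)" and \<rho>: "real_distribution \<rho>"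
    and wc: "weak_conv_m (law \<circ> id \<circ> r) \<rho>"
    using tight_imp_convergent_subsubsequence[of law id] by (auto simp: strict_mono_id)
  obtain V where V[measurable]: "random_variable borel V" and V_law: "distr M borel V = \<rho>"
    using exists_real_law[OF W atomless \<rho>] by blast
  have lim: "(\<lambda>n. expectation (\<lambda>\<omega>. f (Y (r n) \<omega>))) \<longlonglongrightarrow> expectation (\<lambda>\<omega>. f (\<phi> (V \<omega>)))"
    if f: "continuous_on UNIV f" "\<And>x. \<bar>f x\<bar> \<le> B" for f :: "'b \<Rightarrow> real" and B
  proof -
    have f\<phi>: "continuous_on UNIV (\<lambda>t. f (\<phi> t))" by (rule continuous_on_compose2[OF f(1) \<phi>]) auto
    have meas[measurable]: "(\<lambda>t. f (\<phi> t)) \<in> borel_measurable borel"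
      by (rule borel_measurable_continuous_onI[OF f\<phi>])
    have "(\<lambda>n. integral\<^sup>L ((law \<circ> id \<circ> r) n) (\<lambda>t. f (\<phi> t))) \<longlonglongrightarrow> integral\<^sup>L \<rho> (\<lambda>t. f (\<phi> t))"
      using weak_conv_imp_integral_bdd_continuous_conv[OF _ \<rho> wc, of "\<lambda>t. f (\<phi> t)" B] law f(2) f\<phi>
      by (auto simp: continuous_on_eq_continuous_at)
    moreover have "integral\<^sup>L ((law \<circ> id \<circ> r) n) (\<lambda>t. f (\<phi> t)) = expectation (\<lambda>\<omega>. f (Y (r n) \<omega>))" for n
    proof -
      have "integral\<^sup>L (law (r n)) (\<lambda>t. f (\<phi> t)) = expectation (\<lambda>\<omega>. f (\<phi> (\<psi> (Y (r n) \<omega>))))"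
        unfolding law_def by (intro integral_distr) measurable
      also have "\<dots> = expectation (\<lambda>\<omega>. f (Y (r n) \<omega>))"
        by (intro Bochner_Integration.integral_cong) (simp_all add: \<phi>\<psi> Y_K)
      finally show ?thesis by simp
    qed
    moreover have "integral\<^sup>L \<rho> (\<lambda>t. f (\<phi> t)) = expectation (\<lambda>\<omega>. f (\<phi> (V \<omega>)))"
      unfolding V_law[symmetric] by (intro integral_distr) measurable
    ultimately show ?thesis by simp
  qed
  \<comment> \<open>The curve also leaves \<open>K\<close>, but the mean distance from \<open>K\<close> passes to the limit.\<close>
  have AE_K: "AE \<omega> in M. \<phi> (V \<omega>) \<in> K"
  proof -
    let ?g = "\<lambda>x. min 1 (infdist x K)"
    have g: "continuous_on UNIV ?g" by (intro continuous_intros)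
    have gm[measurable]: "?g \<in> borel_measurable borel" by (rule borel_measurable_continuous_onI[OF g])
    have "(\<lambda>n. expectation (\<lambda>\<omega>. ?g (Y (r n) \<omega>))) \<longlonglongrightarrow> expectation (\<lambda>\<omega>. ?g (\<phi> (V \<omega>)))"
      by (rule lim[OF g, of 1]) (simp add: infdist_nonneg)
    moreover have "expectation (\<lambda>\<omega>. ?g (Y (r n) \<omega>)) = expectation (\<lambda>\<omega>. 0)" for n
      by (intro Bochner_Integration.integral_cong) (simp_all add: Y_K)
    ultimately have "expectation (\<lambda>\<omega>. ?g (\<phi> (V \<omega>))) = 0" by (simp add: LIMSEQ_const_iff)
    moreover have "integrable M (\<lambda>\<omega>. ?g (\<phi> (V \<omega>)))"
      by (rule integrable_const_bound[of _ 1]) (auto simp: infdist_nonneg)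
    ultimately have "AE \<omega> in M. ?g (\<phi> (V \<omega>)) = 0"
      by (subst (asm) integral_nonneg_eq_0_iff_AE) (auto simp: infdist_nonneg)
    then show ?thesis
      by eventually_elim (use in_closed_iff_infdist_zero[OF compact_imp_closed[OF K(1)] K(2)] in \<open>auto simp: min_def split: if_splits\<close>)
  qed
  obtain k where "k \<in> K" using K(2) by blast
  define \<eta> where "\<eta> \<omega> = (if \<phi> (V \<omega>) \<in> K then \<phi> (V \<omega>) else k)" for \<omega>
  have [measurable]: "K \<in> sets borel" using K(1) by (simp add: borel_compact)
  have \<eta>: "random_variable (borel_on K) \<eta>"
    unfolding \<eta>_def by (subst measurable_restrict_space2_iff) (auto simp: \<open>k \<in> K\<close>)
  have "(\<lambda>n. expectation (\<lambda>\<omega>. f (Y (r n) \<omega>))) \<longlonglongrightarrow> expectation (\<lambda>\<omega>. f (\<eta> \<omega>))"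
    if f: "continuous_on K f" for f :: "'b \<Rightarrow> real"
  proof -
    obtain B where B: "0 < B" "\<And>x. x \<in> K \<Longrightarrow> norm (f x) \<le> B"
      using compact_imp_bounded[OF compact_continuous_image[OF f K(1)]] unfolding bounded_pos by auto
    obtain g where g: "continuous_on UNIV g" "\<And>x. x \<in> K \<Longrightarrow> g x = f x" "\<And>x. norm (g x) \<le> B"
      using Tietze[OF f, of UNIV B] compact_imp_closed[OF K(1)] B by auto
    have gm[measurable]: "g \<in> borel_measurable borel" by (rule borel_measurable_continuous_onI[OF g(1)])
    have "(\<lambda>n. expectation (\<lambda>\<omega>. g (Y (r n) \<omega>))) \<longlonglongrightarrow> expectation (\<lambda>\<omega>. g (\<phi> (V \<omega>)))"
      using lim[OF g(1), of B] g(3) by simp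
    moreover have "expectation (\<lambda>\<omega>. g (Y (r n) \<omega>)) = expectation (\<lambda>\<omega>. f (Y (r n) \<omega>))" for n
      by (intro Bochner_Integration.integral_cong) (simp_all add: g(2) Y_K)
    moreover have "expectation (\<lambda>\<omega>. g (\<phi> (V \<omega>))) = expectation (\<lambda>\<omega>. g (\<eta> \<omega>))"
    proof (rule integral_cong_AE)
      show "(\<lambda>\<omega>. g (\<eta> \<omega>)) \<in> borel_measurable M" unfolding \<eta>_def by measurable
      show "AE \<omega> in M. g (\<phi> (V \<omega>)) = g (\<eta> \<omega>)" using AE_K by eventually_elim (simp add: \<eta>_def)
    qed measurable
    moreover have "expectation (\<lambda>\<omega>. g (\<eta> \<omega>)) = expectation (\<lambda>\<omega>. f (\<eta> \<omega>))"
      using \<open>k \<in> K\<close> by (intro Bochner_Integration.integral_cong) (auto simp: \<eta>_def g(2))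
    ultimately show ?thesis by simp
  qed
  then show thesis using that \<eta> r by blast
qed

text \<open>The indicators of the events \<open>X i \<in> B\<close> are independent coin tosses. Used as digits of a point of the
  Cantor set they give a variable each of whose values fixes the outcome of all the tosses.\<close>

lemma exists_atomless_variable:
  fixes X :: "nat \<Rightarrow> 'a \<Rightarrow> 'b"
  assumes indep: "indep_vars (\<lambda>_. N) X {1..}" and B: "B \<in> sets N"
    and p: "\<And>i. 1 \<le> i \<Longrightarrow> prob (X i -` B \<inter> space M) = p" "0 < p" "p < 1"
  obtains W :: "'a \<Rightarrow> real" where "random_variable borel W" "\<And>w. prob {\<omega> \<in> space M. W \<omega> = w} = 0"
proof -
  have X[measurable]: "random_variable N (X (Suc i))" for i
    using indep by (auto simp: indep_vars_def)
  define b where "b \<omega> i = (X (Suc i) \<omega> \<in> B)" for \<omega> i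
  define W where "W \<omega> = cantor (b \<omega>)" for \<omega>
  have W: "random_variable borel W"
  proof -
    have "(\<lambda>\<omega>. of_bool (b \<omega> i) :: real) \<in> borel_measurable M" for i
      unfolding b_def of_bool_def using B by measurable
    then show ?thesis unfolding W_def cantor_def by measurable
  qed
  have "prob {\<omega> \<in> space M. W \<omega> = w} = 0" for w
  proof -
    \<comment> \<open>The digits of \<open>w\<close>, recovered from the number \<open>w\<close> itself.\<close>
    define \<beta> where "\<beta> i = (ramp (3 ^ i * w) = 1)" for i
    define A where "A i = (if \<beta> (i - 1) then B else space N - B)" for i
    define q where "q = max p (1 - p)"
    have q: "0 \<le> q" "q < 1" using p by (auto simp: q_def)
    have A_sets: "A i \<in> sets N" for i using B by (simp add: A_def sets.compl_sets)
    have bound: "prob (X i -` A i \<inter> space M) \<le> q" if i: "1 \<le> i" for i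
    proof (cases "\<beta> (i - 1)")
      case False
      have Xi: "random_variable N (X i)" using X[of "i - 1"] i by simp
      have "X i -` A i \<inter> space M = space M - (X i -` B \<inter> space M)"
        using False measurable_space[OF Xi] by (auto simp: A_def)
      then show ?thesis using p(1)[OF i] measurable_sets[OF Xi B] by (simp add: prob_compl q_def)
    qed (use p(1)[OF i] in \<open>simp add: A_def q_def\<close>)
    have le: "prob {\<omega> \<in> space M. W \<omega> = w} \<le> q ^ n" for n
    proof (cases "n = 0")
      case False
      have "prob {\<omega> \<in> space M. W \<omega> = w} \<le> prob (\<Inter>i\<in>{1..n}. X i -` A i \<inter> space M)"
      proof (rule finite_measure_mono)
        show "{\<omega> \<in> space M. W \<omega> = w} \<subseteq> (\<Inter>i\<in>{1..n}. X i -` A i \<inter> space M)"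
        proof safe
          fix \<omega> i assume \<omega>: "\<omega> \<in> space M" "w = W \<omega>" and i: "i \<in> {1..n}"
          have "\<beta> (i - 1) = b \<omega> (i - 1)"
            unfolding \<beta>_def \<omega>(2) W_def ramp_cantor by simp
          then show "\<omega> \<in> X i -` A i" using i measurable_space[OF X \<omega>(1), of "i - 1"] by (auto simp: A_def b_def)
        qed
        have "X i -` A i \<inter> space M \<in> events" if "i \<in> {1..n}" for i
          using measurable_sets[OF X A_sets, of "i - 1" i] that by simp
        then show "(\<Inter>i\<in>{1..n}. X i -` A i \<inter> space M) \<in> events" using False by (intro sets.finite_INT) auto
      qed
      also have "\<dots> = (\<Prod>i\<in>{1..n}. prob (X i -` A i \<inter> space M))"
        using False by (intro indep_varsD[OF indep] A_sets) auto
      also have "\<dots> \<le> (\<Prod>i\<in>{1..n}. q)" by (intro prod_mono conjI measure_nonneg bound) auto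
      finally show ?thesis by simp
    qed simp
    have "prob {\<omega> \<in> space M. W \<omega> = w} \<le> 0"
      by (rule LIMSEQ_le[OF tendsto_const LIMSEQ_power_zero[of q]]) (use q le in auto)
    then show ?thesis using measure_nonneg[of M] by (simp add: order_antisym)
  qed
  then show thesis using that W by blast
qed

end

section \<open>Haar measure as limit of the random walk\<close>

text \<open>The indicator of an open set \<open>U\<close>, other than the whole space, is the increasing limit of the
  functions \<open>min 1 (n * infdist x (- U))\<close>,
  and the open sets generate the Borel sets.\<close>

lemma measure_eqI_continuous_integrals:
  fixes K :: "'a::metric_space set"
  assumes "prob_space N1" "prob_space N2"
    and sets: "sets N1 = sets (borel_on K)" "sets N2 = sets (borel_on K)"
    and eq: "\<And>f :: 'a \<Rightarrow> real. continuous_on K f \<Longrightarrow> bounded (f ` K) \<Longrightarrow> integral\<^sup>L N1 f = integral\<^sup>L N2 f"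
  shows "N1 = N2"
proof -
  interpret N1: prob_space N1 by fact
  interpret N2: prob_space N2 by fact
  have space: "space N1 = K" "space N2 = K"
    using sets_eq_imp_space_eq[OF sets(1)] sets_eq_imp_space_eq[OF sets(2)] by (simp_all add: space_restrict_space)
  have meas: "f \<in> borel_measurable N" if "continuous_on K f" "sets N = sets (borel_on K)" for f :: "'a \<Rightarrow> real" and N
    using borel_measurable_continuous_on_restrict[OF that(1)] measurable_cong_sets[OF that(2) refl] by blast
  have open_eq: "emeasure N1 (U \<inter> K) = emeasure N2 (U \<inter> K)" if U: "open U" for U
  proof (cases "U = UNIV")
    case True
    then show ?thesis using N1.emeasure_space_1 N2.emeasure_space_1 by (simp add: space)
  next
    case False
    define f where "f n x = min 1 (real n * infdist x (- U))" for n x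
    have f_cont: "continuous_on K (f n)" for n unfolding f_def by (intro continuous_intros)
    have f_bound: "\<bar>f n x\<bar> \<le> 1" for n x by (simp add: f_def infdist_nonneg)
    have f_lim: "(\<lambda>n. f n x) \<longlonglongrightarrow> indicator (U \<inter> K) x" if "x \<in> K" for x
    proof (cases "x \<in> U")
      case True
      have "infdist x (- U) \<noteq> 0"
        using in_closed_iff_infdist_zero[of "- U" x] U False True by auto
      then have "0 < infdist x (- U)" using infdist_nonneg[of x "- U"] by linarith
      then obtain n0 where n0: "1 < real n0 * infdist x (- U)" using reals_Archimedean3 by blast
      have "f n x = 1" if "n0 \<le> n" for n
      proof -
        have "real n0 * infdist x (- U) \<le> real n * infdist x (- U)"
          using that by (intro mult_right_mono) (auto simp: infdist_nonneg)
        then show ?thesis using n0 by (simp add: f_def)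
      qed
      then have "eventually (\<lambda>n. f n x = indicator (U \<inter> K) x) sequentially"
        using True \<open>x \<in> K\<close> by (auto simp: eventually_sequentially)
      then show ?thesis by (rule tendsto_eventually)
    next
      case False
      then show ?thesis by (simp add: f_def)
    qed
    have meas_UK: "U \<inter> K \<in> Sigma_Algebra.sets N" if "sets N = sets (borel_on K)" for N
      using U that by (auto simp: sets_restrict_space)
    have "(\<lambda>n. integral\<^sup>L N (f n)) \<longlonglongrightarrow> measure N (U \<inter> K)"
      if "prob_space N" "sets N = sets (borel_on K)" "space N = K" for N
    proof -
      interpret prob_space N by fact
      have "(\<lambda>n. integral\<^sup>L N (f n)) \<longlonglongrightarrow> integral\<^sup>L N (indicator (U \<inter> K))"
      proof (rule integral_dominated_convergence[where w="\<lambda>_. 1"])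
        show "indicator (U \<inter> K) \<in> borel_measurable N" using meas_UK[OF that(2)] by simp
        show "f n \<in> borel_measurable N" for n by (rule meas[OF f_cont that(2)])
        show "AE x in N. (\<lambda>n. f n x) \<longlonglongrightarrow> indicator (U \<inter> K) x" using f_lim that(3) by (intro AE_I2) simp
        show "AE x in N. norm (f n x) \<le> 1" for n using f_bound by simp
      qed simp
      then show ?thesis using that(3) by (simp add: Int_assoc)
    qed
    note lim = this[OF assms(1) sets(1) space(1)] this[OF assms(2) sets(2) space(2)]
    have "integral\<^sup>L N1 (f n) = integral\<^sup>L N2 (f n)" for n
      using f_bound by (intro eq f_cont) (auto simp: bounded_real)
    then have "measure N1 (U \<inter> K) = measure N2 (U \<inter> K)" using LIMSEQ_unique[OF lim(1)] lim(2) by simp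
    then show ?thesis by (simp add: N1.emeasure_eq_measure N2.emeasure_eq_measure)
  qed
  have id: "(\<lambda>x. x) \<in> measurable N1 borel" "(\<lambda>x. x) \<in> measurable N2 borel"
    using sets by (auto simp: measurable_def space sets_restrict_space)
  have "distr N1 borel (\<lambda>x. x) = distr N2 borel (\<lambda>x. x)"
  proof (rule measure_eqI_generator_eq[of "{U. open U}" UNIV _ _ "\<lambda>_. UNIV"])
    show "emeasure (distr N1 borel (\<lambda>x. x)) U = emeasure (distr N2 borel (\<lambda>x. x)) U" if "U \<in> {U. open U}" for U
      using open_eq[of U] that id by (simp add: emeasure_distr space vimage_def)
    show "emeasure (distr N1 borel (\<lambda>x. x)) UNIV \<noteq> \<infinity>"
      using id by (simp add: emeasure_distr N1.emeasure_eq_measure)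
  qed (auto simp: Int_stable_def sets_borel)
  then have dist_eq: "emeasure (distr N1 borel (\<lambda>x. x)) A = emeasure (distr N2 borel (\<lambda>x. x)) A" for A by simp
  show ?thesis
  proof (rule measure_eqI)
    show "sets N1 = sets N2" using sets by simp
    fix A assume "A \<in> sets N1"
    then obtain B where B: "B \<in> sets borel" "A = B \<inter> K" by (auto simp: sets sets_restrict_space)
    then show "emeasure N1 A = emeasure N2 A"
      using dist_eq[of B] id by (simp add: emeasure_distr space vimage_def)
  qed
qed

lemma continuous_map_measurable_borel_on:
  assumes "continuous_on K h" "h ` K \<subseteq> L"
  shows "h \<in> measurable (borel_on K) (borel_on L)"
  using borel_measurable_continuous_on_restrict[OF assms(1)] assms(2)
  by (subst measurable_restrict_space2_iff) (auto simp: space_restrict_space)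

lemma borel_measurable_matrix_mult [measurable (raw)]:
  fixes f g :: "'a \<Rightarrow> real^'n^'n"
  assumes "f \<in> borel_measurable N" "g \<in> borel_measurable N"
  shows "(\<lambda>x. f x ** g x) \<in> borel_measurable N"
  using assms by (rule borel_measurable_continuous_Pair) (intro continuous_intros)

context compact_matrix_group
begin

lemma measurable_mult:
  assumes "f \<in> measurable N (borel_on K)" "g \<in> measurable N (borel_on K)"
  shows "(\<lambda>x. f x ** g x) \<in> measurable N (borel_on K)"
  using assms by (auto simp: measurable_restrict_space2_iff intro!: mult_mem borel_measurable_matrix_mult)

text \<open>A left invariant probability measure is invariant under inversion: integrate \<open>f (x^-1 y)\<close> over both
  variables. Integrating over \<open>y\<close> first gives the integral of \<open>f\<close>; integrating over \<open>x\<close> first, and writing the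
  integrand as \<open>f ((y^-1 x)^-1)\<close>, gives the integral of \<open>f\<close> composed with inversion. Inversion exchanges left
  and right translations, so right invariance follows.\<close>

lemma haar_probability_if_left_invariant:
  assumes \<nu>: "prob_space \<nu>" and sets: "sets \<nu> = sets (borel_on K)"
    and left: "\<And>f g. continuous_on K f \<Longrightarrow> g \<in> K \<Longrightarrow> (\<integral>x. f (g ** x) \<partial>\<nu>) = (\<integral>x. f x \<partial>\<nu> :: real)"
  shows "haar_probability K \<nu>"
proof -
  interpret random_walk K \<nu>
    using \<nu> sets by (simp add: random_walk_def random_walk_axioms_def compact_matrix_group_axioms)
  interpret pair_prob_space \<nu> \<nu> ..
  have meas_cong: "measurable \<nu> N = measurable (borel_on K) N" for N :: "'c measure"
    by (rule measurable_cong_sets[OF sets refl])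
  have continuous_inv: "continuous_on K (\<lambda>x. f (matrix_inv x))" if "continuous_on K f" for f :: "real^'n^'n \<Rightarrow> real"
    by (rule continuous_on_compose2[OF that continuous_on_matrix_inv]) (auto intro: inv_mem)
  have inversion: "(\<integral>x. f (matrix_inv x) \<partial>\<nu>) = (\<integral>x. f x \<partial>\<nu>)" if f: "continuous_on K f" for f :: "real^'n^'n \<Rightarrow> real"
  proof -
    define F where "F x y = f (matrix_inv x ** y)" for x y :: "real^'n^'n"
    obtain B where B: "\<And>x. x \<in> K \<Longrightarrow> \<bar>f x\<bar> \<le> B" using continuous_imp_bounded[OF f] by blast
    have "matrix_inv \<in> measurable \<nu> (borel_on K)" unfolding meas_cong
      by (rule continuous_map_measurable_borel_on[OF continuous_on_matrix_inv]) (auto intro: inv_mem)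
    moreover have "(\<lambda>x. x) \<in> measurable \<nu> (borel_on K)" unfolding meas_cong by (rule measurable_ident_sets[OF refl])
    ultimately have "(\<lambda>z. matrix_inv (fst z) ** snd z) \<in> measurable (\<nu> \<Otimes>\<^sub>M \<nu>) (borel_on K)"
      by (intro measurable_mult) (auto intro: measurable_compose[OF measurable_fst] measurable_compose[OF measurable_snd])
    then have "(\<lambda>z. f (matrix_inv (fst z) ** snd z)) \<in> borel_measurable (\<nu> \<Otimes>\<^sub>M \<nu>)"
      by (rule measurable_compose) (rule borel_measurable_continuous_on_restrict[OF f])
    moreover have "\<bar>f (matrix_inv (fst z) ** snd z)\<bar> \<le> B" if "z \<in> space (\<nu> \<Otimes>\<^sub>M \<nu>)" for z
      using that by (intro B mult_mem inv_mem) (auto simp: space_pair_measure)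
    ultimately have "integrable (\<nu> \<Otimes>\<^sub>M \<nu>) (\<lambda>z. f (matrix_inv (fst z) ** snd z))"
      by (intro P.integrable_const_bound[of _ B] AE_I2) simp_all
    then have "integrable (\<nu> \<Otimes>\<^sub>M \<nu>) (case_prod F)"
      by (simp only: F_def case_prod_beta')
    then have "(\<integral>y. (\<integral>x. F x y \<partial>\<nu>) \<partial>\<nu>) = (\<integral>x. (\<integral>y. F x y \<partial>\<nu>) \<partial>\<nu>)" by (rule Fubini_integral)
    moreover have inner: "(\<integral>x. F x y \<partial>\<nu>) = (\<integral>x. f (matrix_inv x) \<partial>\<nu>)" if y: "y \<in> K" for y
    proof -
      have "matrix_inv (matrix_inv y ** x) = matrix_inv x ** y" if "x \<in> K" for x
        by (rule matrix_inv_unique)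
          (simp add: matrix_mul_assoc matrix_inv_mult_cancel invertible that inv_left y)
      then have "(\<integral>x. F x y \<partial>\<nu>) = (\<integral>x. f (matrix_inv (matrix_inv y ** x)) \<partial>\<nu>)"
        by (intro Bochner_Integration.integral_cong) (auto simp: F_def)
      then show ?thesis using left[OF continuous_inv[OF f] inv_mem[OF y]] by simp
    qed
    have "(\<integral>y. (\<integral>x. F x y \<partial>\<nu>) \<partial>\<nu>) = (\<integral>y. (\<integral>x. f (matrix_inv x) \<partial>\<nu>) \<partial>\<nu>)"
      by (rule Bochner_Integration.integral_cong[OF refl]) (simp add: inner)
    moreover have "(\<integral>x. (\<integral>y. F x y \<partial>\<nu>) \<partial>\<nu>) = (\<integral>x. (\<integral>y. f y \<partial>\<nu>) \<partial>\<nu>)"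
      by (rule Bochner_Integration.integral_cong[OF refl]) (simp add: F_def left[OF f inv_mem])
    ultimately show ?thesis by (simp add: prob_space.prob_space[OF \<nu>, unfolded space_step_law])
  qed
  have right: "(\<integral>x. f (x ** g) \<partial>\<nu>) = (\<integral>x. f x \<partial>\<nu>)" if f: "continuous_on K f" and g: "g \<in> K"
    for f :: "real^'n^'n \<Rightarrow> real" and g
  proof -
    have fg: "continuous_on K (\<lambda>x. f (x ** g))"
      by (rule continuous_on_compose2[OF f]) (auto intro!: continuous_intros mult_mem g)
    have "matrix_inv (matrix_inv g ** x) = matrix_inv x ** g" if "x \<in> K" for x
      by (rule matrix_inv_unique)
        (simp add: matrix_mul_assoc matrix_inv_mult_cancel invertible that inv_left g)
    then have "(\<integral>x. f (matrix_inv x ** g) \<partial>\<nu>) = (\<integral>x. f (matrix_inv (matrix_inv g ** x)) \<partial>\<nu>)"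
      by (intro Bochner_Integration.integral_cong) auto
    then show ?thesis
      using inversion[OF fg] left[OF continuous_inv[OF f] inv_mem[OF g]] inversion[OF f] by simp
  qed
  have invariant: "distr \<nu> (borel_on K) h = \<nu>"
    if h: "continuous_on K h" "h ` K \<subseteq> K" and int: "\<And>f. continuous_on K f \<Longrightarrow> (\<integral>x. f (h x) \<partial>\<nu>) = (\<integral>x. f x \<partial>\<nu> :: real)"
    for h :: "real^'n^'n \<Rightarrow> real^'n^'n"
  proof (rule measure_eqI_continuous_integrals[of _ _ K])
    have hm: "h \<in> measurable \<nu> (borel_on K)"
      unfolding meas_cong by (rule continuous_map_measurable_borel_on[OF h])
    then show "prob_space (distr \<nu> (borel_on K) h)" by (rule prob_space.prob_space_distr[OF \<nu>])
    show "integral\<^sup>L (distr \<nu> (borel_on K) h) f = integral\<^sup>L \<nu> f" if "continuous_on K f" for f :: "real^'n^'n \<Rightarrow> real"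
      using int[OF that] by (subst integral_distr[OF hm borel_measurable_continuous_on_restrict[OF that]])
  qed (use \<nu> sets in auto)
  have "distr \<nu> (borel_on K) (\<lambda>x. g ** x) = \<nu>" "distr \<nu> (borel_on K) (\<lambda>x. x ** g) = \<nu>" if "g \<in> K" for g
    using that left right by (auto intro!: invariant continuous_intros mult_mem)
  then show ?thesis using \<nu> sets by (simp add: haar_probability_def)
qed

end

lemma ordered_product_cong:
  "(\<And>i. 1 \<le> i \<Longrightarrow> i \<le> n \<Longrightarrow> x i = y i) \<Longrightarrow> ordered_product x n = ordered_product y n"
  by (induction n) auto

lemma (in compact_matrix_group) measurable_ordered_product:
  assumes "\<And>i. 1 \<le> i \<Longrightarrow> i \<le> n \<Longrightarrow> X i \<in> measurable N (borel_on K)"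
  shows "(\<lambda>\<omega>. ordered_product (\<lambda>i. X i \<omega>) n) \<in> measurable N (borel_on K)"
  using assms
proof (induction n)
  case 0
  have "mat 1 \<in> space (borel_on K)" using one_mem by (simp add: space_restrict_space)
  then show ?case by simp
next
  case (Suc n)
  then show ?case by (simp add: measurable_mult)
qed

locale random_walk_sequence = random_walk K \<mu> + P: prob_space M
  for K :: "(real^'n^'n) set" and \<mu> and M :: "'w measure" +
  fixes X :: "nat \<Rightarrow> 'w \<Rightarrow> real^'n^'n"
  assumes indep: "P.indep_vars (\<lambda>_. borel_on K) X {1..}"
    and identically_distributed: "\<And>n. 1 \<le> n \<Longrightarrow> distr M (borel_on K) (X n) = \<mu>"
begin

lemma measurable_step: "1 \<le> n \<Longrightarrow> X n \<in> measurable M (borel_on K)"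
  using indep by (auto simp: P.indep_vars_def)

definition position :: "nat \<Rightarrow> 'w \<Rightarrow> real^'n^'n" where
  "position n \<omega> = ordered_product (\<lambda>i. X i \<omega>) n"

lemma measurable_position: "position n \<in> measurable M (borel_on K)"
  unfolding position_def[abs_def] by (intro measurable_ordered_product measurable_step)

lemma position_mem: "\<omega> \<in> space M \<Longrightarrow> position n \<omega> \<in> K"
  using measurable_space[OF measurable_position] by (simp add: space_restrict_space)

lemma indep_position_step: "P.indep_var (borel_on K) (position n) (borel_on K) (X (Suc n))"
proof -
  let ?A = "{1..n}" and ?B = "{Suc n}" and ?N = "\<lambda>_. borel_on K"
  have "P.indep_var (borel_on K) ((\<lambda>x. ordered_product x n) \<circ> (\<lambda>\<omega>. restrict (\<lambda>i. X i \<omega>) ?A))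
      (borel_on K) ((\<lambda>x. x (Suc n)) \<circ> (\<lambda>\<omega>. restrict (\<lambda>i. X i \<omega>) ?B))"
  proof (rule P.indep_var_compose[OF P.indep_var_restrict[OF indep]])
    show "(\<lambda>x. ordered_product x n) \<in> measurable (PiM ?A ?N) (borel_on K)"
      using measurable_ordered_product[of n "\<lambda>i x. x i" "PiM ?A ?N"] by simp
  qed auto
  moreover have "(\<lambda>x. ordered_product x n) \<circ> (\<lambda>\<omega>. restrict (\<lambda>i. X i \<omega>) ?A) = position n"
    unfolding position_def[abs_def] comp_def by (intro ext ordered_product_cong) auto
  moreover have "(\<lambda>x. x (Suc n)) \<circ> (\<lambda>\<omega>. restrict (\<lambda>i. X i \<omega>) ?B) = X (Suc n)"
    by (auto simp: comp_def)
  ultimately show ?thesis by simp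
qed

text \<open>The last step is independent of the position before it, so conditioning on that position replaces
  \<open>f\<close> by \<open>step f\<close>.\<close>

lemma expectation_position:
  assumes "continuous_on K f"
  shows "P.expectation (\<lambda>\<omega>. f (position n \<omega>)) = (step ^^ n) f (mat 1)"
  using assms
proof (induction n arbitrary: f)
  case 0
  then show ?case by (simp add: position_def P.prob_space)
next
  case (Suc n)
  let ?D = "distr M (borel_on K) (position n)"
  have X: "X (Suc n) \<in> measurable M (borel_on K)" by (rule measurable_step) simp
  interpret D: prob_space ?D by (rule P.prob_space_distr[OF measurable_position])
  interpret pair: pair_prob_space ?D \<mu> ..
  have joint: "?D \<Otimes>\<^sub>M \<mu> = distr M (borel_on K \<Otimes>\<^sub>M borel_on K) (\<lambda>\<omega>. (position n \<omega>, X (Suc n) \<omega>))"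
    using P.indep_var_distribution_eq[THEN iffD1, OF indep_position_step] identically_distributed by simp
  have sets_pair: "sets (?D \<Otimes>\<^sub>M \<mu>) = sets (borel_on K \<Otimes>\<^sub>M borel_on K)"
    by (intro sets_pair_measure_cong) (simp_all add: sets_step_law)
  obtain B where B: "\<And>x. x \<in> K \<Longrightarrow> \<bar>f x\<bar> \<le> B" using continuous_imp_bounded[OF Suc.prems] by blast
  have meas: "(\<lambda>z. f (fst z ** snd z)) \<in> borel_measurable (borel_on K \<Otimes>\<^sub>M borel_on K)"
    by (rule measurable_compose[OF measurable_mult borel_measurable_continuous_on_restrict[OF Suc.prems]]) auto
  have "integrable (?D \<Otimes>\<^sub>M \<mu>) (\<lambda>z. f (fst z ** snd z))"
  proof (rule pair.P.integrable_const_bound[of _ B])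
    show "AE z in ?D \<Otimes>\<^sub>M \<mu>. norm (f (fst z ** snd z)) \<le> B"
    proof (rule AE_I2)
      fix z assume "z \<in> space (?D \<Otimes>\<^sub>M \<mu>)"
      then have "fst z ** snd z \<in> K" by (intro mult_mem) (auto simp: space_pair_measure space_restrict_space)
      then show "norm (f (fst z ** snd z)) \<le> B" using B by simp
    qed
    show "(\<lambda>z. f (fst z ** snd z)) \<in> borel_measurable (?D \<Otimes>\<^sub>M \<mu>)"
      using meas measurable_cong_sets[OF sets_pair refl] by blast
  qed
  then have int: "integrable (?D \<Otimes>\<^sub>M \<mu>) (case_prod (\<lambda>x y. f (x ** y)))" by (simp add: case_prod_beta')
  have "P.expectation (\<lambda>\<omega>. f (position (Suc n) \<omega>)) = P.expectation (\<lambda>\<omega>. f (position n \<omega> ** X (Suc n) \<omega>))"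
    by (simp add: position_def)
  also have "\<dots> = (\<integral>z. f (fst z ** snd z) \<partial>(?D \<Otimes>\<^sub>M \<mu>))"
    unfolding joint by (subst integral_distr[OF _ meas]) (use measurable_position X in auto)
  also have "\<dots> = (\<integral>x. step f x \<partial>?D)"
    using pair.integral_fst'[OF int] unfolding step_def by (simp add: case_prod_beta')
  also have "\<dots> = P.expectation (\<lambda>\<omega>. step f (position n \<omega>))"
    using iter_continuous[OF Suc.prems, of 1]
    by (intro integral_distr[OF measurable_position] borel_measurable_continuous_on_restrict) simp
  also have "\<dots> = (step ^^ n) (step f) (mat 1)"
    using Suc.IH iter_continuous[OF Suc.prems, of 1] by simp
  finally show ?case by (simp add: funpow_swap1)
qed

lemma prob_step_in:
  assumes "1 \<le> i" "B \<in> sets (borel_on K)"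
  shows "P.prob (X i -` B \<inter> space M) = measure \<mu> B"
  using measure_distr[OF measurable_step assms(2)] identically_distributed assms(1) by metis

text \<open>By uniform mixing the expectations of \<open>f\<close> along the walk converge. A weakly convergent subsequence of positions,
  realized by \<open>\<eta>\<close>, identifies these limits with the integrals of \<open>f\<close> against the law of \<open>\<eta>\<close>, and left
  invariance of the limit mean becomes left invariance of that law.\<close>

theorem converges_to_haar:
  assumes s: "s \<in> topological_support" and dense: "K \<subseteq> increment_group topological_support s"
  obtains \<eta> where "\<eta> \<in> measurable M (borel_on K)"
    "haar_probability K (distr M (borel_on K) \<eta>)"
    "\<And>f. continuous_on K f \<Longrightarrow> (\<lambda>n. P.expectation (\<lambda>\<omega>. f (position n \<omega>))) \<longlonglongrightarrow> P.expectation (\<lambda>\<omega>. f (\<eta> \<omega>) :: real)"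
proof -
  have limit: "(\<lambda>n. P.expectation (\<lambda>\<omega>. f (position n \<omega>))) \<longlonglongrightarrow> limit_mean f" if "continuous_on K f" for f
    unfolding expectation_position[OF that] by (rule iter_tendsto_limit_mean[OF s dense that one_mem])
  have "\<exists>\<eta> r. \<eta> \<in> measurable M (borel_on K) \<and> strict_mono (r :: nat \<Rightarrow> nat) \<and>
      (\<forall>f :: real^'n^'n \<Rightarrow> real. continuous_on K f \<longrightarrow> (\<lambda>n. P.expectation (\<lambda>\<omega>. f (position (r n) \<omega>))) \<longlonglongrightarrow> P.expectation (\<lambda>\<omega>. f (\<eta> \<omega>)))"
  \<comment> \<open>A deterministic step leaves no randomness to build \<open>\<eta>\<close> from, but then \<open>K\<close> is the trivial group.\<close>
  proof (cases "topological_support = {s}")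
    case True
    have pow: "set_power topological_support j = {matrix_power s j}" for j
      unfolding True by (induction j) (auto simp: matrix_power_Suc_left simp del: ordered_product.simps(2))
    have sK: "s \<in> K" using s topological_support_subset by blast
    have "increments topological_support s j \<subseteq> {mat 1}" for j
      using invertible_mult_cancel_left[OF invertible[OF power_mem[OF sK]], of j _ "mat 1"]
      by (auto simp: increments_def pow)
    then have "increment_group topological_support s \<subseteq> {mat 1}"
      unfolding increment_group_def by (intro closure_minimal) auto
    then have K1: "K = {mat 1}" using dense one_mem by blast
    have const: "P.expectation (\<lambda>\<omega>. f (position n \<omega>)) = P.expectation (\<lambda>\<omega>. f (position 0 \<omega>))" for f :: "real^'n^'n \<Rightarrow> real" and n
      using position_mem K1 by (intro Bochner_Integration.integral_cong) auto
    have "(\<lambda>n. P.expectation (\<lambda>\<omega>. f (position (id n) \<omega>))) \<longlonglongrightarrow> P.expectation (\<lambda>\<omega>. f (position 0 \<omega>))"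
      for f :: "real^'n^'n \<Rightarrow> real"
      by (rule tendsto_eventually) (intro always_eventually allI const)
    then show ?thesis using measurable_position strict_mono_id by blast
  next
    case False
    then obtain t where t: "t \<in> topological_support" "t \<noteq> s" using s by blast
    \<comment> \<open>Two disjoint balls of positive measure make \<open>B\<close> an event of probability strictly between \<open>0\<close> and \<open>1\<close>.\<close>
    define B where "B = ball s (dist s t / 2) \<inter> K"
    define C where "C = ball t (dist s t / 2) \<inter> K"
    have BC: "B \<in> sets (borel_on K)" "C \<in> sets (borel_on K)" by (auto simp: B_def C_def sets_restrict_space)
    have pos: "0 < measure \<mu> B" "0 < measure \<mu> C"
      using s t by (auto simp: topological_support_def B_def C_def)
    have False if "x \<in> B" "x \<in> C" for x
      using that dist_triangle[of s t x] by (simp add: B_def C_def dist_commute)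
    then have "B \<inter> C = {}" by blast
    then have "measure \<mu> B + measure \<mu> C = measure \<mu> (B \<union> C)"
      using BC by (intro finite_measure_Union[symmetric]) (auto simp: sets_step_law)
    also have "\<dots> \<le> 1" by (rule prob_le_1)
    finally have "measure \<mu> B < 1" using pos by linarith
    then obtain W :: "'w \<Rightarrow> real" where W: "P.random_variable borel W" "\<And>w. P.prob {\<omega> \<in> space M. W \<omega> = w} = 0"
      using P.exists_atomless_variable[OF indep BC(1) prob_step_in[OF _ BC(1)] pos(1)] by blast
    have ne: "K \<noteq> {}" using one_mem by blast
    obtain \<eta> and r :: "nat \<Rightarrow> nat" where "\<eta> \<in> measurable M (borel_on K)" "strict_mono r"
      "\<And>f :: real^'n^'n \<Rightarrow> real. continuous_on K f \<Longrightarrow>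
        (\<lambda>n. P.expectation (\<lambda>\<omega>. f (position (r n) \<omega>))) \<longlonglongrightarrow> P.expectation (\<lambda>\<omega>. f (\<eta> \<omega>))"
      by (rule P.weak_limit_of_subsequence[where Y = position, OF compact ne measurable_position W]) blast
    then show ?thesis by blast
  qed
  then obtain \<eta> and r :: "nat \<Rightarrow> nat" where \<eta>: "\<eta> \<in> measurable M (borel_on K)" and r: "strict_mono r"
    and sub: "\<And>f :: real^'n^'n \<Rightarrow> real. continuous_on K f \<Longrightarrow>
      (\<lambda>n. P.expectation (\<lambda>\<omega>. f (position (r n) \<omega>))) \<longlonglongrightarrow> P.expectation (\<lambda>\<omega>. f (\<eta> \<omega>))" by blast
  have mean: "P.expectation (\<lambda>\<omega>. f (\<eta> \<omega>)) = limit_mean f" if f: "continuous_on K f" for f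
    using LIMSEQ_unique[OF sub[OF f]] LIMSEQ_subseq_LIMSEQ[OF limit[OF f] r] by (simp add: comp_def)
  have "haar_probability K (distr M (borel_on K) \<eta>)"
  proof (rule haar_probability_if_left_invariant)
    show "prob_space (distr M (borel_on K) \<eta>)" by (rule P.prob_space_distr[OF \<eta>])
    fix f :: "real^'n^'n \<Rightarrow> real" and g assume f: "continuous_on K f" and g: "g \<in> K"
    note fg = continuous_on_left_mult[OF f g]
    have "(\<integral>x. f (g ** x) \<partial>distr M (borel_on K) \<eta>) = limit_mean (\<lambda>x. f (g ** x))"
      by (subst integral_distr[OF \<eta> borel_measurable_continuous_on_restrict[OF fg]]) (rule mean[OF fg])
    also have "\<dots> = limit_mean f" by (rule limit_mean_left_invariant[OF s dense f g])
    also have "\<dots> = (\<integral>x. f x \<partial>distr M (borel_on K) \<eta>)"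
      by (subst integral_distr[OF \<eta> borel_measurable_continuous_on_restrict[OF f]]) (rule mean[OF f, symmetric])
    finally show "(\<integral>x. f (g ** x) \<partial>distr M (borel_on K) \<eta>) = (\<integral>x. f x \<partial>distr M (borel_on K) \<eta>)" .
  qed simp
  then show thesis using that \<eta> limit mean by simp
qed

end

section \<open>Algebraic subgroups and their cosets\<close>

lemma general_linear_simps [simp]:
  "carrier general_linear = {A. invertible A}" "mult general_linear = (**)" "one general_linear = mat 1"
  by (simp_all add: general_linear_def)

lemma matrix_group_simps [simp]:
  "carrier (matrix_group G) = G" "mult (matrix_group G) = (**)" "one (matrix_group G) = mat 1"
  by (simp_all add: matrix_group_def)

lemma (in compact_matrix_group) group_matrix_group: "group (matrix_group K)"
proof (rule groupI)
  fix x assume "x \<in> carrier (matrix_group K)"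
  then show "\<exists>y\<in>carrier (matrix_group K). y \<otimes>\<^bsub>matrix_group K\<^esub> x = \<one>\<^bsub>matrix_group K\<^esub>"
    using inv_mem inv_left by (intro bexI[of _ "matrix_inv x"]) auto
qed (auto simp: one_mem mult_mem matrix_mul_assoc)

lemma (in compact_matrix_group) m_inv_matrix_group: "x \<in> K \<Longrightarrow> inv\<^bsub>matrix_group K\<^esub> x = matrix_inv x"
  using group.inv_equality[OF group_matrix_group, of "matrix_inv x" x] by (simp add: inv_left inv_mem)

lemma compact_algebraic_group_is_compact_matrix_group:
  assumes "compact_algebraic_group G"
  shows "compact_matrix_group G"
proof -
  have G: "subgroup G general_linear" "compact G"
    using assms by (auto simp: compact_algebraic_group_def algebraic_group_def)
  have "G \<subseteq> {A. invertible A}" using subgroup.subset[OF G(1)] by simp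
  then show ?thesis
    using G subgroup.m_closed[OF G(1)] subgroup.one_closed[OF G(1)] by (intro compact_semigroup_is_group) auto
qed

text \<open>Inside a compact matrix group being algebraic is a topological condition: zero sets are closed, and
  conversely compact groups are zero sets.\<close>

lemma (in compact_matrix_group) algebraic_subgroup_iff:
  "algebraic_subgroup H K \<longleftrightarrow> H \<subseteq> K \<and> compact_matrix_group H"
proof
  assume H: "algebraic_subgroup H K"
  then have sub: "subgroup H (matrix_group K)" by (simp add: algebraic_subgroup_def)
  have HK: "H \<subseteq> K" using subgroup.subset[OF sub] by simp
  obtain P where P: "\<forall>p\<in>P. real_polynomial_function p" "H = {A. invertible A \<and> (\<forall>p\<in>P. p A = 0)}"
    using H by (auto simp: algebraic_subgroup_def zariski_closed_def)
  have "H = K \<inter> (\<Inter>p\<in>P. {A. p A = 0})" using HK invertible P(2) by auto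
  moreover have "closed (\<Inter>p\<in>P. {A. p A = 0})"
    using P(1) continuous_on_real_polynomial by (intro closed_INT ballI closed_Collect_eq continuous_on_const) auto
  ultimately have "compact H" using compact_Int_closed[OF compact] by simp
  then show "H \<subseteq> K \<and> compact_matrix_group H"
    using HK invertible subgroup.m_closed[OF sub] subgroup.one_closed[OF sub]
    by (auto intro!: compact_semigroup_is_group)
next
  assume H: "H \<subseteq> K \<and> compact_matrix_group H"
  then interpret H: compact_matrix_group H by simp
  have "subgroup H (matrix_group K)"
    using H by (intro group.subgroupI[OF group_matrix_group])
      (auto simp: H.mult_mem m_inv_matrix_group subset_iff H.inv_mem intro: H.one_mem)
  then show "algebraic_subgroup H K" using H.zariski_closed by (simp add: algebraic_subgroup_def)
qed

lemma (in compact_matrix_group) normalizer_cosets_iff: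
  assumes "H \<subseteq> K"
  shows "Z \<in> normalizer_cosets K H \<longleftrightarrow>
    (\<exists>z\<in>K. (\<lambda>h. z ** h ** matrix_inv z) ` H = H \<and> Z = (\<lambda>h. z ** h) ` H)"
proof -
  have "normalizer (matrix_group K) H = {z \<in> K. (\<lambda>h. z ** h ** matrix_inv z) ` H = H}"
  proof -
    have "z <#\<^bsub>matrix_group K\<^esub> H #>\<^bsub>matrix_group K\<^esub> (inv\<^bsub>matrix_group K\<^esub> z) = (\<lambda>h. z ** h ** matrix_inv z) ` H"
      if "z \<in> K" for z
      using that by (auto simp: l_coset_def r_coset_def m_inv_matrix_group)
    then show ?thesis using assms unfolding normalizer_def stabilizer_def by auto
  qed
  then show ?thesis
    by (auto simp: normalizer_cosets_def LCOSETS_def l_coset_def)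
qed

lemma (in random_walk) topological_support_subset_closed:
  assumes "closed C" "AE y in \<mu>. y \<in> C"
  shows "topological_support \<subseteq> C"
proof
  fix y assume y: "y \<in> topological_support"
  show "y \<in> C"
  proof (rule ccontr)
    assume "y \<notin> C"
    then obtain e where e: "0 < e" "ball y e \<subseteq> - C"
      using assms(1) open_contains_ball[of "- C"] by (auto simp: closed_def)
    have B: "ball y e \<inter> K \<in> sets \<mu>" by (auto simp: sets_step_law sets_restrict_space)
    have "AE y' in \<mu>. y' \<notin> ball y e \<inter> K" using assms(2) by eventually_elim (use e(2) in auto)
    then have "measure \<mu> (ball y e \<inter> K) = 0"
      using B by (intro measure_eq_0_null_sets) (simp only: AE_iff_null_sets)
    then show False using y e(1) by (auto simp: topological_support_def)
  qed
qed

lemma AE_distr_borel_on_closed: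
  assumes "\<zeta> \<in> measurable M (borel_on G)" "closed C"
  shows "(AE x in distr M (borel_on G) \<zeta>. x \<in> C) \<longleftrightarrow> (AE \<omega> in M. \<zeta> \<omega> \<in> C)"
  using assms
  by (intro AE_distr_iff) (auto simp: sets_restrict_space space_restrict_space intro!: image_eqI[of _ _ C])

lemma (in compact_matrix_group) random_walk_of_variable:
  assumes "prob_space M" "\<zeta> \<in> measurable M (borel_on K)"
  shows "random_walk K (distr M (borel_on K) \<zeta>)"
  using prob_space.prob_space_distr[OF assms]
  by (simp add: random_walk_def random_walk_axioms_def compact_matrix_group_axioms)

text \<open>Every closed set that carries \<open>\<xi>\<close> contains the topological support of its law. Hence the intersection of
  all algebraic subgroups carrying \<open>\<xi>\<close>, possibly uncountably many, still carries \<open>\<xi>\<close>.\<close>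

lemma (in compact_matrix_group) supp_is_least:
  assumes M: "prob_space M" and \<xi>: "\<xi> \<in> measurable M (borel_on K)"
  shows "algebraic_subgroup (supp M K \<xi>) K" "AE \<omega> in M. \<xi> \<omega> \<in> supp M K \<xi>"
    and "\<And>H. algebraic_subgroup H K \<Longrightarrow> (AE \<omega> in M. \<xi> \<omega> \<in> H) \<Longrightarrow> supp M K \<xi> \<subseteq> H"
proof -
  let ?\<mu> = "distr M (borel_on K) \<xi>"
  interpret random_walk K ?\<mu> by (rule random_walk_of_variable[OF M \<xi>])
  define \<H> where "\<H> = {H. algebraic_subgroup H K \<and> (AE \<omega> in M. \<xi> \<omega> \<in> H)}"
  have grp: "compact_matrix_group H" "H \<subseteq> K" if "H \<in> \<H>" for H
    using that by (auto simp: \<H>_def algebraic_subgroup_iff)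
  have "AE \<omega> in M. \<xi> \<omega> \<in> K"
    using measurable_space[OF \<xi>] by (intro AE_I2) (simp add: space_restrict_space)
  then have K: "K \<in> \<H>" by (simp add: \<H>_def algebraic_subgroup_iff compact_matrix_group_axioms)
  have "topological_support \<subseteq> H" if "H \<in> \<H>" for H
    using that compact_matrix_group.closed[OF grp(1)[OF that]] AE_distr_borel_on_closed[OF \<xi>]
    by (intro topological_support_subset_closed) (auto simp: \<H>_def)
  then have "topological_support \<subseteq> \<Inter>\<H>" by blast
  then have AE_mu: "AE y in ?\<mu>. y \<in> \<Inter>\<H>" using AE_topological_support by (auto elim: AE_mp)
  have closed_Inter: "closed (\<Inter>\<H>)" using grp compact_matrix_group.closed by (intro closed_Inter) blast
  have AE_Inter: "AE \<omega> in M. \<xi> \<omega> \<in> \<Inter>\<H>"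
    using AE_mu AE_distr_borel_on_closed[OF \<xi> closed_Inter] by simp
  have "compact_matrix_group (\<Inter>\<H>)"
  proof
    show "compact (\<Inter>\<H>)" using compact_Int_closed[OF compact closed_Inter] K by (simp add: Int_absorb1 Inter_lower)
    show "invertible x" if "x \<in> \<Inter>\<H>" for x using that K invertible by blast
    show "mat 1 \<in> \<Inter>\<H>" by (intro InterI compact_matrix_group.one_mem grp(1))
    show "x ** y \<in> \<Inter>\<H>" if "x \<in> \<Inter>\<H>" "y \<in> \<Inter>\<H>" for x y
      by (intro InterI compact_matrix_group.mult_mem grp(1)) (use that in auto)
    show "matrix_inv x \<in> \<Inter>\<H>" if "x \<in> \<Inter>\<H>" for x
      by (intro InterI compact_matrix_group.inv_mem grp(1)) (use that in auto)
  qed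
  then have alg: "algebraic_subgroup (\<Inter>\<H>) K" using K by (auto simp: algebraic_subgroup_iff)
  have "supp M K \<xi> = \<Inter>\<H>"
    unfolding supp_def by (rule Least_equality) (use alg AE_Inter in \<open>auto simp: \<H>_def\<close>)
  then show "algebraic_subgroup (supp M K \<xi>) K" "AE \<omega> in M. \<xi> \<omega> \<in> supp M K \<xi>"
    "\<And>H. algebraic_subgroup H K \<Longrightarrow> (AE \<omega> in M. \<xi> \<omega> \<in> H) \<Longrightarrow> supp M K \<xi> \<subseteq> H"
    using alg AE_Inter by (auto simp: \<H>_def)
qed

section \<open>The four conditions\<close>

locale compact_group_products = compact_matrix_group G + prob_space M
  for G :: "(real^'n^'n) set" and M :: "'w measure" +
  fixes \<xi> :: "'w \<Rightarrow> real^'n^'n" and X :: "nat \<Rightarrow> 'w \<Rightarrow> real^'n^'n"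
  assumes measurable_\<xi>: "\<xi> \<in> measurable M (borel_on G)"
    and indep: "indep_vars (\<lambda>_. borel_on G) X {1..}"
    and same_law: "\<And>n. n \<ge> 1 \<Longrightarrow> distr M (borel_on G) (X n) = distr M (borel_on G) \<xi>"
begin

definition product :: "nat \<Rightarrow> 'w \<Rightarrow> real^'n^'n" where
  "product n \<omega> = ordered_product (\<lambda>i. X i \<omega>) n"

lemma measurable_X: "1 \<le> n \<Longrightarrow> X n \<in> measurable M (borel_on G)"
  using indep by (auto simp: indep_vars_def)

lemma measurable_product: "product n \<in> measurable M (borel_on G)"
  unfolding product_def[abs_def] by (intro measurable_ordered_product measurable_X)

lemma mem_G: "\<zeta> \<in> measurable M (borel_on G) \<Longrightarrow> \<omega> \<in> space M \<Longrightarrow> \<zeta> \<omega> \<in> G"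
  using measurable_space[of \<zeta> M "borel_on G" \<omega>] by (simp add: space_restrict_space)

lemma AE_X_iff:
  assumes "closed C" "1 \<le> n"
  shows "(AE \<omega> in M. X n \<omega> \<in> C) \<longleftrightarrow> (AE \<omega> in M. \<xi> \<omega> \<in> C)"
  unfolding AE_distr_borel_on_closed[OF measurable_X[OF assms(2)] assms(1), symmetric]
    AE_distr_borel_on_closed[OF measurable_\<xi> assms(1), symmetric] same_law[OF assms(2)] ..

lemma AE_all_X:
  assumes "closed C" "AE \<omega> in M. \<xi> \<omega> \<in> C"
  shows "AE \<omega> in M. \<forall>n\<ge>1. X n \<omega> \<in> C"
  using AE_X_iff[OF assms(1)] assms(2) by (subst AE_all_countable) (auto intro: AE_impI)

text \<open>The mean distance from \<open>C\<close> tends to \<open>0\<close> along the products of length \<open>m n\<close>, since translation by \<open>a n\<close>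
  moves the points of \<open>C\<close> by uniformly small amounts.\<close>

lemma limit_in_closed_set:
  assumes conv: "converges_in_distribution M G product \<eta>" and \<eta>: "\<eta> \<in> measurable M (borel_on G)"
    and C: "closed C" "C \<noteq> {}" "C \<subseteq> G" and m: "filterlim m at_top sequentially"
    and a: "a \<longlonglongrightarrow> mat 1" "\<And>n. a n \<in> G"
    and product_in: "\<And>n. AE \<omega> in M. \<exists>c\<in>C. product (m n) \<omega> = a n ** c"
  shows "AE \<omega> in M. \<eta> \<omega> \<in> C"
proof -
  interpret W: random_walk G "distr M (borel_on G) \<xi>"
    by (rule random_walk_of_variable[OF prob_space_axioms measurable_\<xi>])
  let ?f = "\<lambda>x. infdist x C"
  have f: "continuous_on G ?f" by (intro continuous_intros)
  obtain B where B: "\<And>x. x \<in> G \<Longrightarrow> \<bar>?f x\<bar> \<le> B" using W.continuous_imp_bounded[OF f] by blast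
  have int: "integrable M (\<lambda>\<omega>. ?f (\<zeta> \<omega>))" if "\<zeta> \<in> measurable M (borel_on G)" for \<zeta>
    using B mem_G[OF that] measurable_compose[OF that borel_measurable_continuous_on_restrict[OF f]]
    by (intro integrable_const_bound[of _ B] AE_I2) auto
  have "bounded (?f ` G)" using B by (auto simp: bounded_real)
  then have "(\<lambda>n. expectation (\<lambda>\<omega>. ?f (product n \<omega>))) \<longlonglongrightarrow> expectation (\<lambda>\<omega>. ?f (\<eta> \<omega>))"
    using conv f unfolding converges_in_distribution_def by blast
  from filterlim_compose[OF this m]
  have lim: "(\<lambda>n. expectation (\<lambda>\<omega>. ?f (product (m n) \<omega>))) \<longlonglongrightarrow> expectation (\<lambda>\<omega>. ?f (\<eta> \<omega>))" .
  have "expectation (\<lambda>\<omega>. ?f (\<eta> \<omega>)) \<le> e" if e: "0 < e" for e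
  proof -
    obtain d where d: "0 < d" "\<And>x x' k. \<lbrakk>x \<in> G; x' \<in> G; k \<in> G; dist x x' < d\<rbrakk> \<Longrightarrow> \<bar>?f (x ** k) - ?f (x' ** k)\<bar> \<le> e"
      using W.uniform_modulus[OF f e] by blast
    have "eventually (\<lambda>n. dist (a n) (mat 1) < d) sequentially" by (rule tendstoD[OF a(1) d(1)])
    then have "eventually (\<lambda>n. expectation (\<lambda>\<omega>. ?f (product (m n) \<omega>)) \<le> e) sequentially"
    proof eventually_elim
      case (elim n)
      have small: "?f (a n ** c) \<le> e" if "c \<in> C" for c
        using d(2)[OF a(2) one_mem _ elim, of c] C that infdist_zero[OF that] by auto
      have "AE \<omega> in M. ?f (product (m n) \<omega>) \<le> e" using product_in[of n] by eventually_elim (auto simp: small)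
      then have "expectation (\<lambda>\<omega>. ?f (product (m n) \<omega>)) \<le> expectation (\<lambda>_. e)"
        using int[OF measurable_product] by (intro integral_mono_AE) auto
      then show ?case by (simp add: prob_space)
    qed
    then show ?thesis using lim by (intro tendsto_upperbound[OF lim]) auto
  qed
  then have "expectation (\<lambda>\<omega>. ?f (\<eta> \<omega>)) \<le> 0" by (rule field_le_epsilon) simp
  moreover have "0 \<le> expectation (\<lambda>\<omega>. ?f (\<eta> \<omega>))"
    by (intro Bochner_Integration.integral_nonneg infdist_nonneg)
  ultimately have "expectation (\<lambda>\<omega>. ?f (\<eta> \<omega>)) = 0" by (rule antisym)
  then have "AE \<omega> in M. ?f (\<eta> \<omega>) = 0"
    using int[OF \<eta>] by (subst (asm) integral_nonneg_eq_0_iff_AE) (auto simp: infdist_nonneg)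
  then show ?thesis by eventually_elim (simp add: in_closed_iff_infdist_zero[OF C(1,2)])
qed

text \<open>Along the return times \<open>k n\<close> of \<open>z\<close> the products approach \<open>H\<close>, and one step later they approach \<open>zH\<close>.
  Both cosets then carry the limit, so they intersect.\<close>

theorem convergence_imp_trivial_coset:
  assumes conv: "converges_in_distribution M G product \<eta>" and \<eta>: "\<eta> \<in> measurable M (borel_on G)"
    and H: "algebraic_subgroup H G" and Z: "Z \<in> normalizer_cosets G H" and \<xi>_in: "AE \<omega> in M. \<xi> \<omega> \<in> Z"
  shows "Z = H"
proof -
  interpret H: compact_matrix_group H using H by (simp add: algebraic_subgroup_iff)
  have HG: "H \<subseteq> G" using H by (simp add: algebraic_subgroup_iff)
  obtain z where z: "z \<in> G" "(\<lambda>h. z ** h ** matrix_inv z) ` H = H" "Z = (\<lambda>h. z ** h) ` H"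
    using Z normalizer_cosets_iff[OF HG] by blast
  have commute: "\<exists>h'\<in>H. h ** z = z ** h'" if "h \<in> H" for h
  proof -
    have "h \<in> (\<lambda>h. z ** h ** matrix_inv z) ` H" by (simp only: z(2) that)
    then obtain h' where h': "h' \<in> H" "h = z ** h' ** matrix_inv z" by (rule imageE) auto
    then have "h ** z = z ** h'"
      by (simp add: matrix_inv_mult_cancel invertible[OF z(1)])
    then show ?thesis using h'(1) by blast
  qed
  have "compact Z" unfolding z(3) by (intro compact_continuous_image H.compact continuous_intros)
  then have clZ: "closed Z" by (rule compact_imp_closed)
  have ZG: "Z \<subseteq> G" using z HG mult_mem by auto
  have product_in: "AE \<omega> in M. \<exists>h\<in>H. product n \<omega> = matrix_power z n ** h" for n
    using AE_all_X[OF clZ \<xi>_in]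
  proof eventually_elim
    case (elim \<omega>)
    show ?case
    proof (induction n)
      case 0
      then show ?case using H.one_mem by (intro bexI[of _ "mat 1"]) (auto simp: product_def)
    next
      case (Suc n)
      then obtain h where h: "h \<in> H" "product n \<omega> = matrix_power z n ** h" by blast
      obtain g where g: "g \<in> H" "X (Suc n) \<omega> = z ** g" using elim z(3) by auto
      obtain h' where h': "h' \<in> H" "h ** z = z ** h'" using commute[OF h(1)] by blast
      have "product (Suc n) \<omega> = matrix_power z n ** (h ** z) ** g"
        using h g by (simp add: product_def matrix_mul_assoc)
      also have "\<dots> = matrix_power z (Suc n) ** (h' ** g)" by (simp add: h' matrix_mul_assoc)
      finally show ?case using H.mult_mem[OF h'(1) g(1)] by blast
    qed
  qed
  obtain k :: "nat \<Rightarrow> nat" where k: "\<And>n. n \<le> k n" "(\<lambda>n. matrix_power z (k n)) \<longlonglongrightarrow> mat 1"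
    using powers_return_to_one[OF compact power_mem[OF z(1)] invertible] by blast
  have k_top: "filterlim k at_top sequentially"
    by (rule filterlim_at_top_mono[OF filterlim_ident]) (simp add: k(1))
  have "AE \<omega> in M. \<eta> \<omega> \<in> H"
    by (rule limit_in_closed_set[OF conv \<eta> H.closed _ HG k_top k(2) power_mem[OF z(1)] product_in])
      (use H.one_mem in blast)
  moreover have "AE \<omega> in M. \<eta> \<omega> \<in> Z"
  proof (rule limit_in_closed_set[OF conv \<eta> clZ _ ZG filterlim_compose[OF filterlim_Suc k_top] k(2) power_mem[OF z(1)]])
    show "Z \<noteq> {}" using z(3) H.one_mem by blast
    show "AE \<omega> in M. \<exists>c\<in>Z. product (Suc (k n)) \<omega> = matrix_power z (k n) ** c" for n
      using product_in[of "Suc (k n)"] by eventually_elim (auto simp: z(3) matrix_mul_assoc)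
  qed
  ultimately have "AE \<omega> in M. \<eta> \<omega> \<in> H \<and> \<eta> \<omega> \<in> Z" by eventually_elim simp
  from eventually_happens'[OF ae_filter_bot this] obtain \<omega> where \<omega>: "\<eta> \<omega> \<in> H" "\<eta> \<omega> \<in> Z" by auto
  from \<omega>(2) obtain h where "h \<in> H" "\<eta> \<omega> = z ** h" unfolding z(3) by (rule imageE) auto
  then have h: "h \<in> H" "z ** h \<in> H" using \<omega>(1) by simp_all
  have zH: "z \<in> H"
    using H.mult_mem[OF h(2) H.inv_mem[OF h(1)]] by (simp add: matrix_inv_mult_cancel H.invertible[OF h(1)])
  show ?thesis
  proof
    show "Z \<subseteq> H" using z(3) H.mult_mem[OF zH] by blast
    show "H \<subseteq> Z"
    proof
      fix h assume "h \<in> H"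
      then have "h = z ** (matrix_inv z ** h)" "matrix_inv z ** h \<in> H"
        using H.mult_mem[OF H.inv_mem[OF zH]] by (simp_all add: matrix_inv_mult_cancel H.invertible[OF zH])
      then show "h \<in> Z" using z(3) by blast
    qed
  qed
qed

theorem trivial_cosets_imp_full_subgroup:
  assumes cosets: "\<And>H Z. algebraic_subgroup H G \<Longrightarrow> Z \<in> normalizer_cosets G H \<Longrightarrow> (AE \<omega> in M. \<xi> \<omega> \<in> Z) \<Longrightarrow> Z = H"
    and H: "algebraic_subgroup H (supp M G \<xi>)" and Z: "Z \<in> normalizer_cosets G H" "AE \<omega> in M. \<xi> \<omega> \<in> Z"
  shows "H = supp M G \<xi>"
proof -
  note least = supp_is_least[OF prob_space_axioms measurable_\<xi>]
  have supp_sub: "supp M G \<xi> \<subseteq> G" and "compact_matrix_group (supp M G \<xi>)"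
    using least(1) by (auto simp: algebraic_subgroup_iff)
  then have HS: "H \<subseteq> supp M G \<xi>" "compact_matrix_group H"
    using H compact_matrix_group.algebraic_subgroup_iff by blast+
  then have HG: "algebraic_subgroup H G" using supp_sub by (auto simp: algebraic_subgroup_iff)
  have "Z = H" by (rule cosets[OF HG Z])
  then show ?thesis using least(3)[OF HG] Z(2) HS(1) by auto
qed

text \<open>The hypothesis, applied to the increment group \<open>E\<close> of the topological support and to its coset \<open>sE\<close>, says that
  \<open>E\<close> is the whole support \<open>K\<close> of \<open>\<xi>\<close>. This is the density that lets the walk converge to Haar measure on \<open>K\<close>.\<close>

theorem full_subgroup_imp_haar_limit:
  assumes full: "\<And>H Z. algebraic_subgroup H (supp M G \<xi>) \<Longrightarrow> Z \<in> normalizer_cosets G H \<Longrightarrow>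
      (AE \<omega> in M. \<xi> \<omega> \<in> Z) \<Longrightarrow> H = supp M G \<xi>"
  obtains \<eta> where "\<eta> \<in> measurable M (borel_on G)" "converges_in_distribution M G product \<eta>"
    "uniform_law_on M G (supp M G \<xi>) \<eta>"
proof -
  define K where "K = supp M G \<xi>"
  note least = supp_is_least[OF prob_space_axioms measurable_\<xi>, folded K_def]
  have KG: "K \<subseteq> G" using least(1) by (simp add: algebraic_subgroup_iff)
  interpret K: compact_matrix_group K using least(1) by (simp add: algebraic_subgroup_iff)
  \<comment> \<open>The variables lie in \<open>K\<close> only almost surely; redefining them on a null set turns them into steps of a
    walk on \<open>K\<close>.\<close>
  define h where "h x = (if x \<in> K then x else mat 1)" for x :: "real^'n^'n"
  have h: "h \<in> measurable (borel_on G) (borel_on K)"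
  proof (subst measurable_restrict_space2_iff, intro conjI)
    have "h \<in> borel_measurable borel"
      unfolding h_def using borel_closed[OF K.closed] by measurable
    then show "h \<in> borel_measurable (borel_on G)" by (rule measurable_restrict_space1)
    show "h \<in> space (borel_on G) \<rightarrow> K" using K.one_mem by (auto simp: h_def)
  qed
  have h_id: "AE \<omega> in M. h (\<xi> \<omega>) = \<xi> \<omega>" using least(2) by eventually_elim (simp add: h_def)
  define \<mu> where "\<mu> = distr M (borel_on K) (\<lambda>\<omega>. h (\<xi> \<omega>))"
  have h\<xi>: "(\<lambda>\<omega>. h (\<xi> \<omega>)) \<in> measurable M (borel_on K)" by (rule measurable_compose[OF measurable_\<xi> h])
  interpret W: random_walk K \<mu>
    unfolding \<mu>_def by (rule K.random_walk_of_variable[OF prob_space_axioms h\<xi>])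
  interpret W: random_walk_sequence K \<mu> M "\<lambda>n \<omega>. h (X n \<omega>)"
  proof
    show "indep_vars (\<lambda>_. borel_on K) (\<lambda>n \<omega>. h (X n \<omega>)) {1..}"
      by (rule indep_vars_compose2[OF indep h])
    fix n :: nat assume n: "1 \<le> n"
    have "distr M (borel_on K) (\<lambda>\<omega>. h (X n \<omega>)) = distr (distr M (borel_on G) (X n)) (borel_on K) h"
      by (simp add: distr_distr[OF h measurable_X[OF n]] comp_def)
    also have "\<dots> = \<mu>" by (simp add: same_law[OF n] distr_distr[OF h measurable_\<xi>] comp_def \<mu>_def)
    finally show "distr M (borel_on K) (\<lambda>\<omega>. h (X n \<omega>)) = \<mu>" .
  qed
  let ?S = "W.topological_support"
  obtain s where s: "s \<in> ?S"
    using eventually_happens'[OF W.ae_filter_bot W.AE_topological_support] by blast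
  define E where "E = K.increment_group ?S s"
  have EK: "E \<subseteq> K" unfolding E_def by (rule K.increment_group_subset)
  have E_group: "compact_matrix_group E"
    unfolding E_def by (rule K.increment_group_is_group[OF W.topological_support_subset s])
  have sK: "s \<in> K" using s W.topological_support_subset by blast
  have "E = K"
  proof -
    let ?Z = "(\<lambda>x. s ** x) ` E"
    have E_alg: "algebraic_subgroup E K" using EK E_group by (simp add: K.algebraic_subgroup_iff)
    have conj: "s ** x ** matrix_inv s \<in> E" "matrix_inv s ** x ** s \<in> E" if "x \<in> E" for x
      using that K.conj_inv_increment_group[OF W.topological_support_subset s]
        K.conj_increment_group[OF W.topological_support_subset s] unfolding E_def by blast+
    have "(\<lambda>x. s ** x ** matrix_inv s) ` E = E"
    proof
      show "E \<subseteq> (\<lambda>x. s ** x ** matrix_inv s) ` E"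
      proof
        fix x assume "x \<in> E"
        have "x = s ** (matrix_inv s ** x ** s) ** matrix_inv s"
          by (simp add: matrix_inv_mult_cancel(1)[OF K.invertible[OF sK]] K.inv_right[OF sK]
              flip: matrix_mul_assoc)
        then show "x \<in> (\<lambda>x. s ** x ** matrix_inv s) ` E" using conj(2)[OF \<open>x \<in> E\<close>] by blast
      qed
    qed (use conj(1) in blast)
    then have Z: "?Z \<in> normalizer_cosets G E"
      unfolding normalizer_cosets_iff[OF subset_trans[OF EK KG]] using KG sK by blast
    have "compact ?Z"
      using compact_matrix_group.compact[OF E_group] by (intro compact_continuous_image continuous_intros)
    then have clZ: "closed ?Z" by (rule compact_imp_closed)
    have "?S \<subseteq> ?Z"
    proof
      fix y assume "y \<in> ?S"
      then have "matrix_inv s ** y \<in> E"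
        unfolding E_def by (rule K.subset_coset_increment_group[OF W.topological_support_subset s])
      moreover have "y = s ** (matrix_inv s ** y)" by (simp add: matrix_inv_mult_cancel K.invertible[OF sK])
      ultimately show "y \<in> ?Z" by blast
    qed
    then have "AE y in \<mu>. y \<in> ?Z" using W.AE_topological_support by (auto elim: AE_mp)
    then have "AE \<omega> in M. h (\<xi> \<omega>) \<in> ?Z"
      unfolding \<mu>_def by (subst (asm) AE_distr_borel_on_closed[OF h\<xi> clZ])
    then have "AE \<omega> in M. \<xi> \<omega> \<in> ?Z" using h_id by eventually_elim simp
    then show ?thesis using full[folded K_def, OF E_alg Z] by simp
  qed
  then have "K \<subseteq> K.increment_group ?S s" by (simp add: E_def)
  then obtain \<eta> where \<eta>: "\<eta> \<in> measurable M (borel_on K)" "haar_probability K (distr M (borel_on K) \<eta>)"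
    and lim: "\<And>f :: real^'n^'n \<Rightarrow> real. continuous_on K f \<Longrightarrow>
      (\<lambda>n. expectation (\<lambda>\<omega>. f (W.position n \<omega>))) \<longlonglongrightarrow> expectation (\<lambda>\<omega>. f (\<eta> \<omega>))"
    using W.converges_to_haar[OF s] by blast
  have inclusion: "(\<lambda>x. x) \<in> measurable (borel_on K) (borel_on G)"
    using KG by (intro continuous_map_measurable_borel_on continuous_intros) auto
  have \<eta>G: "\<eta> \<in> measurable M (borel_on G)" using measurable_compose[OF \<eta>(1) inclusion] by simp
  have same_products: "AE \<omega> in M. product n \<omega> = W.position n \<omega>" for n
    using AE_all_X[OF K.closed least(2)]
  proof eventually_elim
    case (elim \<omega>)
    then show ?case unfolding product_def W.position_def by (intro ordered_product_cong) (simp add: h_def)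
  qed
  have "converges_in_distribution M G product \<eta>"
    unfolding converges_in_distribution_def
  proof (intro allI impI)
    fix f :: "real^'n^'n \<Rightarrow> real" assume f: "continuous_on G f \<and> bounded (f ` G)"
    then have fK: "continuous_on K f" using KG continuous_on_subset by blast
    have "expectation (\<lambda>\<omega>. f (product n \<omega>)) = expectation (\<lambda>\<omega>. f (W.position n \<omega>))" for n
    proof (rule integral_cong_AE)
      show "(\<lambda>\<omega>. f (product n \<omega>)) \<in> borel_measurable M"
        using f by (intro measurable_compose[OF measurable_product] borel_measurable_continuous_on_restrict) simp
      show "(\<lambda>\<omega>. f (W.position n \<omega>)) \<in> borel_measurable M"
        by (intro measurable_compose[OF W.measurable_position] borel_measurable_continuous_on_restrict fK)
      show "AE \<omega> in M. f (product n \<omega>) = f (W.position n \<omega>)" using same_products[of n] by eventually_elim simp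
    qed
    then show "(\<lambda>n. expectation (\<lambda>\<omega>. f (product n \<omega>))) \<longlonglongrightarrow> expectation (\<lambda>\<omega>. f (\<eta> \<omega>))"
      using lim[OF fK] by simp
  qed
  moreover have "uniform_law_on M G K \<eta>"
    unfolding uniform_law_on_def
    using \<eta>(2) distr_distr[OF inclusion \<eta>(1)] by (intro exI[of _ "distr M (borel_on K) \<eta>"]) (simp add: comp_def)
  ultimately show thesis using that \<eta>G by (simp add: K_def)
qed

end

theorem theorem2:
  fixes M :: "'w measure"
    and G :: "(real^'n^'n) set"
    and \<xi> :: "'w \<Rightarrow> real^'n^'n"
    and X :: "nat \<Rightarrow> 'w \<Rightarrow> real^'n^'n"
  assumes "prob_space M"
    and "compact_algebraic_group G"
    and "\<xi> \<in> measurable M (borel_on G)"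
    and "prob_space.indep_vars M (\<lambda>_. borel_on G) X {1..}"
    and "\<And>n. n \<ge> 1 \<Longrightarrow> distr M (borel_on G) (X n) = distr M (borel_on G) \<xi>"
  shows
    "let G' = supp M G \<xi>;
         S = (\<lambda>n \<omega>. ordered_product (\<lambda>i. X i \<omega>) n);
         C1 = (\<exists>\<eta> \<in> measurable M (borel_on G). converges_in_distribution M G S \<eta>);
         C2 = (\<exists>\<eta> \<in> measurable M (borel_on G).
                 converges_in_distribution M G S \<eta> \<and> uniform_law_on M G G' \<eta>);
         C3 = (\<forall>H Z. algebraic_subgroup H G' \<and> Z \<in> normalizer_cosets G H \<and>
                 (AE \<omega> in M. \<xi> \<omega> \<in> Z) \<longrightarrow> H = G');
         C4 = (\<forall>H Z. algebraic_subgroup H G \<and> Z \<in> normalizer_cosets G H \<and>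
                 (AE \<omega> in M. \<xi> \<omega> \<in> Z) \<longrightarrow> Z = H)
     in (C1 \<longleftrightarrow> C2) \<and> (C2 \<longleftrightarrow> C3) \<and> (C3 \<longleftrightarrow> C4)"
proof -
  interpret compact_group_products G M \<xi> X
    unfolding compact_group_products_def compact_group_products_axioms_def
    using assms compact_algebraic_group_is_compact_matrix_group by blast
  have S: "(\<lambda>n \<omega>. ordered_product (\<lambda>i. X i \<omega>) n) = product" by (simp add: product_def fun_eq_iff)
  define C1 where "C1 \<longleftrightarrow> (\<exists>\<eta> \<in> measurable M (borel_on G). converges_in_distribution M G product \<eta>)"
  define C2 where "C2 \<longleftrightarrow> (\<exists>\<eta> \<in> measurable M (borel_on G).
      converges_in_distribution M G product \<eta> \<and> uniform_law_on M G (supp M G \<xi>) \<eta>)"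
  define C3 where "C3 \<longleftrightarrow> (\<forall>H Z. algebraic_subgroup H (supp M G \<xi>) \<and> Z \<in> normalizer_cosets G H \<and>
      (AE \<omega> in M. \<xi> \<omega> \<in> Z) \<longrightarrow> H = supp M G \<xi>)"
  define C4 where "C4 \<longleftrightarrow> (\<forall>H Z. algebraic_subgroup H G \<and> Z \<in> normalizer_cosets G H \<and>
      (AE \<omega> in M. \<xi> \<omega> \<in> Z) \<longrightarrow> Z = H)"
  have "C2 \<Longrightarrow> C1" unfolding C1_def C2_def by blast
  moreover have "C1 \<Longrightarrow> C4" unfolding C1_def C4_def using convergence_imp_trivial_coset by blast
  moreover have "C4 \<Longrightarrow> C3" unfolding C4_def C3_def using trivial_cosets_imp_full_subgroup by blast
  moreover have "C3 \<Longrightarrow> C2"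
  proof -
    assume C3
    then have full: "H = supp M G \<xi>"
      if "algebraic_subgroup H (supp M G \<xi>)" "Z \<in> normalizer_cosets G H" "AE \<omega> in M. \<xi> \<omega> \<in> Z" for H Z
      using that unfolding C3_def by blast
    show C2 by (rule full_subgroup_imp_haar_limit[OF full]) (auto simp: C2_def)
  qed
  ultimately have "(C1 \<longleftrightarrow> C2) \<and> (C2 \<longleftrightarrow> C3) \<and> (C3 \<longleftrightarrow> C4)" by blast
  then show ?thesis unfolding Let_def S C1_def C2_def C3_def C4_def .
qed

end
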